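(* Let $(x_1,x_2,x_3,x_4)$ be the coordinates on $M=(0,\infty)\times(0,\infty)\times\mathbb{R}^2$. For $\beta>0$, give $M$ the metric $g_\beta$ whose non-zero components are $$g_\beta(\partial_{x_1},\partial_{x_1})=g_\beta(\partial_{x_2},\partial_{x_2})=1,\quad g_\beta(\partial_{x_3},\partial_{x_3})=x_1^2,\quad g_\beta(\partial_{x_4},\partial_{x_4})=(x_1+\beta x_2)^2.$$ Then: (1) $\mathcal{M}_\beta=(M,g_\beta)$ is a $4$-dimensional Riemannian Puffini--Videv manifold. (2) For all $P\in M$, the $2$-model $\mathfrak{M}_2(\mathcal{M}_\beta,P)$ is indecomposable and $\mathcal{M}_\beta$ is locally irreducible at $P$. (3) $\mathcal{M}_\beta$ is not locally isometric to $\mathcal{M}_\gamma$ for $\beta\neq\gamma$ (with $\beta,\gamma>0$). (4) $\mathcal{M}_\beta$ exhibits scalar curvature blowup and is not Einstein.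
   Context: For a Riemannian manifold $\mathcal{M}=(M,g)$, $R$ is the Riemann curvature tensor, with sign convention such that the scalar curvature $\tau_{\mathcal{M}}=\sum_{ijkl}g^{jk}g^{il}R_{ijkl}$ is positive on round spheres. For $P\in M$ and $k\ge0$, the $k$-model is $\mathfrak{M}_k(\mathcal{M},P)=(T_PM,\langle\cdot,\cdot\rangle=g_P,R_P,\nabla R_P,\dots,\nabla^kR_P)$, and $\mathfrak{M}(\mathcal{M},P)=\mathfrak{M}_0(\mathcal{M},P)$. A $k$-model is decomposable if there is a non-trivial orthogonal decomposition $T_PM=V_1\oplus V_2$ (both $V_i\ne\{0\}$) with respect to which each of the tensors $R_P,\nabla R_P,\dots,\nabla^kR_P$ decomposes as a direct sum of a tensor on $V_1$ and a tensor on $V_2$ (i.e. it vanishes whenever its arguments each lie in $V_1$ or $V_2$ but not all in the same $V_i$); otherwise it is indecomposable. Let $V=T_PM$ and let $\mathcal{A}$ be the curvature operator of $A=R_P$, $\langle\mathcal{A}(v_1,v_2)v_3,v_4\rangle=A(v_1,v_2,v_3,v_4)$. The Jacobi operator is $\mathcal{J}(v)w=\mathcal{A}(w,v)v$. For a subspace $\pi\subset V$ with orthonormal basis $v_1,\dots,v_k$, the higher order Jacobi operator is $\mathcal{J}(\pi)=\sum_{i=1}^k\mathcal{J}(v_i)$ (independent of the basis), and the Ricci operator is $\rho=\mathcal{J}(V)$. The $0$-model $\mathfrak{M}(\mathcal{M},P)$ is Puffini--Videv if $\mathcal{J}(\pi)\mathcal{J}(\pi^\perp)=\mathcal{J}(\pi^\perp)\mathcal{J}(\pi)$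 for every subspace $\pi$ of $V$ (equivalently, $\mathcal{J}(\pi)\rho=\rho\mathcal{J}(\pi)$ for every $\pi$). $\mathcal{M}$ is Puffini--Videv if $\mathfrak{M}(\mathcal{M},P)$ is Puffini--Videv at each $P\in M$. $\mathcal{M}$ is Einstein if its Ricci operator is a scalar multiple of the identity at each point. $\mathcal{M}$ is locally reducible at $P$ if there is a neighborhood $\mathcal{O}$ of $P$ such that $(\mathcal{O},g)=(\mathcal{O}_1\times\mathcal{O}_2,g_1\oplus g_2)$ decomposes as a Cartesian (Riemannian) product of positive-dimensional factors; it is locally irreducible at $P$ if this does not happen. $\mathcal{M}$ exhibits scalar curvature blowup if there is a geodesic $\gamma$ in $\mathcal{M}$ defined on a finite interval $(0,T)$ such that $\lim_{t\to0}|\tau_{\mathcal{M}}(\gamma(t))|=\infty$. "Not locally isometric" means that no non-empty open subset of the one manifold is isometric to an open subset of the other. *)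

theory Defs
  imports "HOL-Analysis.Analysis"
begin

text \<open>
  A Riemannian manifold covered by a single chart: an open subset of a Euclidean space together
  with a metric. Every tangent space is identified with the ambient vector space
  (a vector \<open>v\<close> stands for the coordinate vector field with constant components \<open>v\<close>), so
  \<open>metric M x u v\<close> is \<open>g\<^sub>x(u, v)\<close>. The values of \<open>metric M\<close> outside \<open>points M\<close> are irrelevant.
\<close>

record 'a riem =
  points :: "'a set"
  metric :: "'a \<Rightarrow> 'a \<Rightarrow> 'a \<Rightarrow> real"

text \<open>Continuous differentiability of order \<open>k\<close>, via iterated directional derivatives; only meant
  for open \<open>S\<close>.\<close>

primrec Ck_on :: "nat \<Rightarrow> 'a::euclidean_space set \<Rightarrow> ('a \<Rightarrow> 'b::real_normed_vector) \<Rightarrow> bool" where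
  "Ck_on 0 S f \<longleftrightarrow> continuous_on S f"
| "Ck_on (Suc k) S f \<longleftrightarrow> (\<forall>x\<in>S. f differentiable (at x)) \<and>
     (\<forall>v. Ck_on k S (\<lambda>x. frechet_derivative f (at x) v))"

definition smooth_on :: "'a::euclidean_space set \<Rightarrow> ('a \<Rightarrow> 'b::real_normed_vector) \<Rightarrow> bool" where
  "smooth_on S f \<longleftrightarrow> (\<forall>k. Ck_on k S f)"

definition riemannian_manifold :: "'a::euclidean_space riem \<Rightarrow> bool" where
  "riemannian_manifold M \<longleftrightarrow> open (points M) \<and>
     (\<forall>u v. smooth_on (points M) (\<lambda>x. metric M x u v)) \<and>
     (\<forall>x\<in>points M. bilinear (metric M x) \<and> (\<forall>u v. metric M x u v = metric M x v u) \<and>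
        (\<forall>u. u \<noteq> 0 \<longrightarrow> metric M x u u > 0))"

definition manifold_dim :: "'a::euclidean_space riem \<Rightarrow> nat" where
  "manifold_dim M = DIM('a)"

subsection \<open>Isometries, products, local reducibility\<close>

definition open_part :: "'a riem \<Rightarrow> 'a set \<Rightarrow> 'a riem" where
  "open_part M U = M\<lparr>points := U\<rparr>"

definition isometric :: "'a::euclidean_space riem \<Rightarrow> 'b::euclidean_space riem \<Rightarrow> bool" where
  "isometric M N \<longleftrightarrow> (\<exists>\<phi> \<psi>.
     smooth_on (points M) \<phi> \<and> smooth_on (points N) \<psi> \<and>
     \<phi> ` points M = points N \<and> \<psi> ` points N = points M \<and>
     (\<forall>x\<in>points M. \<psi> (\<phi> x) = x) \<and> (\<forall>y\<in>points N. \<phi> (\<psi> y) = y) \<and>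
     (\<forall>x\<in>points M. \<forall>u v.
        metric N (\<phi> x) (frechet_derivative \<phi> (at x) u) (frechet_derivative \<phi> (at x) v)
          = metric M x u v))"

definition locally_isometric :: "'a::euclidean_space riem \<Rightarrow> 'b::euclidean_space riem \<Rightarrow> bool" where
  "locally_isometric M N \<longleftrightarrow> (\<exists>U V. open U \<and> U \<noteq> {} \<and> U \<subseteq> points M \<and> open V \<and> V \<subseteq> points N \<and>
     isometric (open_part M U) (open_part N V))"

definition riem_product :: "'b riem \<Rightarrow> 'c riem \<Rightarrow> ('b \<times> 'c) riem" where
  "riem_product M N = \<lparr>points = points M \<times> points N,
     metric = (\<lambda>x u v. metric M (fst x) (fst u) (fst v) + metric N (snd x) (snd u) (snd v))\<rparr>"

text \<open>
  Local reducibility at \<open>P\<close> with factors modelled on \<open>'b\<close> and \<open>'c\<close>. Types of class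
  \<open>euclidean_space\<close> have positive dimension, so both factors do. Shrinking the neighbourhood makes
  each factor a single chart, so restricting to factors of this kind is no loss. Local
  irreducibility is the negation for \<^emph>\<open>all\<close> types \<open>'b\<close> and \<open>'c\<close>.
\<close>

definition locally_reducible_at ::
  "'b::euclidean_space itself \<Rightarrow> 'c::euclidean_space itself \<Rightarrow> 'a::euclidean_space riem \<Rightarrow> 'a \<Rightarrow> bool"
where
  "locally_reducible_at _ _ M P \<longleftrightarrow> (\<exists>U (M1 :: 'b riem) (M2 :: 'c riem).
     open U \<and> P \<in> U \<and> U \<subseteq> points M \<and> riemannian_manifold M1 \<and> riemannian_manifold M2 \<and>
     isometric (open_part M U) (riem_product M1 M2))"

subsection \<open>Levi-Civita connection and curvature\<close>

text \<open>The vector dual to the linear form \<open>\<alpha>\<close> with respect to the inner product \<open>ip\<close>.\<close>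

definition sharp :: "('a \<Rightarrow> 'a \<Rightarrow> real) \<Rightarrow> ('a \<Rightarrow> real) \<Rightarrow> 'a" where
  "sharp ip \<alpha> = (THE w. \<forall>z. ip w z = \<alpha> z)"

text \<open>\<open>christoffel M x u v\<close> is \<open>\<nabla>\<^sub>u v\<close> at \<open>x\<close> for the constant vector fields \<open>u\<close> and \<open>v\<close>, given by
  the Koszul formula.\<close>

definition christoffel :: "'a::euclidean_space riem \<Rightarrow> 'a \<Rightarrow> 'a \<Rightarrow> 'a \<Rightarrow> 'a" where
  "christoffel M x u v = sharp (metric M x) (\<lambda>z.
     (frechet_derivative (\<lambda>y. metric M y v z) (at x) u
    + frechet_derivative (\<lambda>y. metric M y u z) (at x) v
    - frechet_derivative (\<lambda>y. metric M y u v) (at x) z) / 2)"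

text \<open>\<open>\<nabla>\<^sub>u\<nabla>\<^sub>v w - \<nabla>\<^sub>v\<nabla>\<^sub>u w\<close> for constant, hence commuting, vector fields.\<close>

definition riem_curvature :: "'a::euclidean_space riem \<Rightarrow> 'a \<Rightarrow> 'a \<Rightarrow> 'a \<Rightarrow> 'a \<Rightarrow> 'a" where
  "riem_curvature M x u v w =
     frechet_derivative (\<lambda>y. christoffel M y v w) (at x) u
   - frechet_derivative (\<lambda>y. christoffel M y u w) (at x) v
   + christoffel M x u (christoffel M x v w) - christoffel M x v (christoffel M x u w)"

text \<open>A covariant \<open>n\<close>-tensor is a function on lists of \<open>n\<close> vectors; its values on lists of any other
  length carry no meaning.\<close>

type_synonym 'a tensor = "'a list \<Rightarrow> real"

definition curvature_tensor :: "'a::euclidean_space riem \<Rightarrow> 'a \<Rightarrow> 'a tensor" where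
  "curvature_tensor M x vs = (case vs of
     [a, b, c, d] \<Rightarrow> metric M x (riem_curvature M x a b c) d | _ \<Rightarrow> 0)"

text \<open>The direction of differentiation is the new first argument:
  \<open>cov_deriv M T x (u # vs) = (\<nabla>\<^sub>u T)(vs)\<close> at \<open>x\<close>.\<close>

fun cov_deriv :: "'a::euclidean_space riem \<Rightarrow> ('a \<Rightarrow> 'a tensor) \<Rightarrow> 'a \<Rightarrow> 'a tensor" where
  "cov_deriv M T x [] = 0"
| "cov_deriv M T x (u # vs) = frechet_derivative (\<lambda>y. T y vs) (at x) u
     - (\<Sum>i<length vs. T x (vs[i := christoffel M x u (vs ! i)]))"

definition nabla_curvature :: "nat \<Rightarrow> 'a::euclidean_space riem \<Rightarrow> 'a \<Rightarrow> 'a tensor" where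
  "nabla_curvature k M = (cov_deriv M ^^ k) (curvature_tensor M)"

subsection \<open>Models\<close>

text \<open>The underlying vector space of a model is the whole type; the \<open>j\<close>-th entry of \<open>tensors\<close> has
  \<open>4 + j\<close> arguments.\<close>

record 'a model =
  form :: "'a \<Rightarrow> 'a \<Rightarrow> real"
  tensors :: "'a tensor list"

definition k_model :: "nat \<Rightarrow> 'a::euclidean_space riem \<Rightarrow> 'a \<Rightarrow> 'a model" where
  "k_model k M P = \<lparr>form = metric M P,
     tensors = map (\<lambda>j. nabla_curvature j M P) [0..<Suc k]\<rparr>"

definition decomposable :: "'a::euclidean_space model \<Rightarrow> bool" where
  "decomposable \<MM> \<longleftrightarrow> (\<exists>V1 V2. subspace V1 \<and> subspace V2 \<and> V1 \<noteq> {0} \<and> V2 \<noteq> {0} \<and>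
     V1 \<inter> V2 = {0} \<and> (\<forall>v. \<exists>a\<in>V1. \<exists>b\<in>V2. v = a + b) \<and>
     (\<forall>a\<in>V1. \<forall>b\<in>V2. form \<MM> a b = 0) \<and>
     (\<forall>j<length (tensors \<MM>). \<forall>vs. length vs = 4 + j \<longrightarrow> set vs \<subseteq> V1 \<union> V2 \<longrightarrow>
        \<not> set vs \<subseteq> V1 \<longrightarrow> \<not> set vs \<subseteq> V2 \<longrightarrow> (tensors \<MM> ! j) vs = 0))"

definition indecomposable :: "'a::euclidean_space model \<Rightarrow> bool" where
  "indecomposable \<MM> \<longleftrightarrow> \<not> decomposable \<MM>"

definition curvature_op :: "'a::euclidean_space model \<Rightarrow> 'a \<Rightarrow> 'a \<Rightarrow> 'a \<Rightarrow> 'a" where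
  "curvature_op \<MM> a b c = sharp (form \<MM>) (\<lambda>z. (tensors \<MM> ! 0) [a, b, c, z])"

definition jacobi_op :: "'a::euclidean_space model \<Rightarrow> 'a \<Rightarrow> 'a \<Rightarrow> 'a" where
  "jacobi_op \<MM> v w = curvature_op \<MM> w v v"

definition orthonormal_basis_of ::
  "('a::euclidean_space \<Rightarrow> 'a \<Rightarrow> real) \<Rightarrow> 'a set \<Rightarrow> 'a set \<Rightarrow> bool" where
  "orthonormal_basis_of ip B W \<longleftrightarrow> finite B \<and> span B = W \<and>
     (\<forall>u\<in>B. \<forall>v\<in>B. ip u v = (if u = v then 1 else 0))"

text \<open>Independent of the choice of the basis.\<close>

definition higher_jacobi_op :: "'a::euclidean_space model \<Rightarrow> 'a set \<Rightarrow> 'a \<Rightarrow> 'a" where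
  "higher_jacobi_op \<MM> W w =
     (\<Sum>v\<in>(SOME B. orthonormal_basis_of (form \<MM>) B W). jacobi_op \<MM> v w)"

definition ricci_op :: "'a::euclidean_space model \<Rightarrow> 'a \<Rightarrow> 'a" where
  "ricci_op \<MM> = higher_jacobi_op \<MM> UNIV"

definition orth_compl :: "('a \<Rightarrow> 'a \<Rightarrow> real) \<Rightarrow> 'a set \<Rightarrow> 'a set" where
  "orth_compl ip W = {v. \<forall>w\<in>W. ip v w = 0}"

definition puffini_videv_model :: "'a::euclidean_space model \<Rightarrow> bool" where
  "puffini_videv_model \<MM> \<longleftrightarrow> (\<forall>W. subspace W \<longrightarrow>
     higher_jacobi_op \<MM> W \<circ> higher_jacobi_op \<MM> (orth_compl (form \<MM>) W)
       = higher_jacobi_op \<MM> (orth_compl (form \<MM>) W) \<circ> higher_jacobi_op \<MM> W)"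

definition puffini_videv :: "'a::euclidean_space riem \<Rightarrow> bool" where
  "puffini_videv M \<longleftrightarrow> (\<forall>P\<in>points M. puffini_videv_model (k_model 0 M P))"

definition einstein :: "'a::euclidean_space riem \<Rightarrow> bool" where
  "einstein M \<longleftrightarrow> (\<forall>P\<in>points M. \<exists>c. ricci_op (k_model 0 M P) = (\<lambda>v. c *\<^sub>R v))"

subsection \<open>Scalar curvature and geodesics\<close>

text \<open>\<open>g\<^sup>i\<^sup>j\<close>, the inverse of the matrix \<open>ip i j\<close> for \<open>i, j \<in> Basis\<close>: the vector dual to the coordinate
  form \<open>dx\<^sup>i\<close> has components \<open>g\<^sup>i\<^sup>j\<close>.\<close>

definition inv_form :: "('a::euclidean_space \<Rightarrow> 'a \<Rightarrow> real) \<Rightarrow> 'a \<Rightarrow> 'a \<Rightarrow> real" where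
  "inv_form ip i j = sharp ip (\<lambda>z. z \<bullet> i) \<bullet> j"

definition scalar_curvature :: "'a::euclidean_space riem \<Rightarrow> 'a \<Rightarrow> real" where
  "scalar_curvature M x = (\<Sum>i\<in>Basis. \<Sum>j\<in>Basis. \<Sum>k\<in>Basis. \<Sum>l\<in>Basis.
     inv_form (metric M x) j k * inv_form (metric M x) i l * curvature_tensor M x [i, j, k, l])"

definition geodesic_on :: "'a::euclidean_space riem \<Rightarrow> real set \<Rightarrow> (real \<Rightarrow> 'a) \<Rightarrow> bool" where
  "geodesic_on M I \<gamma> \<longleftrightarrow> (\<exists>\<gamma>'. \<forall>t\<in>I. \<gamma> t \<in> points M \<and>
     (\<gamma> has_vector_derivative \<gamma>' t) (at t) \<and>
     (\<gamma>' has_vector_derivative - christoffel M (\<gamma> t) (\<gamma>' t) (\<gamma>' t)) (at t))"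

definition scalar_curvature_blowup :: "'a::euclidean_space riem \<Rightarrow> bool" where
  "scalar_curvature_blowup M \<longleftrightarrow> (\<exists>\<gamma> T. T > 0 \<and> geodesic_on M {0<..<T} \<gamma> \<and>
     filterlim (\<lambda>t. \<bar>scalar_curvature M (\<gamma> t)\<bar>) at_top (at_right 0))"

subsection \<open>The family of manifolds\<close>

definition M_beta :: "real \<Rightarrow> (real ^ 4) riem" where
  "M_beta \<beta> = \<lparr>points = {x. x $ 1 > 0 \<and> x $ 2 > 0},
     metric = (\<lambda>x u v. u $ 1 * v $ 1 + u $ 2 * v $ 2 + (x $ 1)\<^sup>2 * (u $ 3 * v $ 3)
       + (x $ 1 + \<beta> * x $ 2)\<^sup>2 * (u $ 4 * v $ 4))\<rparr>"

end

theory Submission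
  imports Defs
begin

text \<open>
  Write \<open>f = x\<^sub>1\<close> and \<open>h = x\<^sub>1 + \<beta> x\<^sub>2\<close>. The metric is a warped product over the flat base with
  coordinates \<open>x\<^sub>1, x\<^sub>2\<close>: the two one-dimensional fibre directions are scaled by \<open>f\<close> and \<open>h\<close>.
  The curvature of a plane that contains a base direction is governed by the Hessians of \<open>f\<close> and \<open>h\<close>,
  which vanish because both functions are affine. What remains is the plane of the two fibres, with
  sectional curvature \<open>- (grad f, grad h) / (f h) = - 1 / (f h)\<close>; as a tensor,
  \<open>R = f h (dx\<^sub>3 \<and> dx\<^sub>4) \<otimes> (dx\<^sub>3 \<and> dx\<^sub>4)\<close> (\<open>curvature_tensor_M_beta\<close>).

  \<^item> Every higher order Jacobi operator kills the base directions and takes values in the fibre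
    plane, and the Ricci operator is \<open>- 1 / (f h)\<close> times the orthogonal projection to that plane. So
    they commute, the manifold is not Einstein, and the scalar curvature \<open>- 2 / (f h)\<close> blows up, as
    \<open>t\<close> tends to \<open>0\<close>, along the geodesic \<open>x\<^sub>1 = t\<close> on which the other coordinates are constant.

  \<^item> If \<open>R\<close> splits along \<open>V\<^sub>1 \<oplus> V\<^sub>2\<close>, the form \<open>dx\<^sub>3 \<and> dx\<^sub>4\<close> lives on one summand only, and then the
    other one consists of base vectors \<open>\<xi>\<close>. The covariant derivatives of \<open>R\<close> along the fibres contain the factors
    \<open>\<xi>(f) / f\<close> and \<open>\<xi>(h) / h\<close>, so a splitting of \<open>\<nabla>R\<close> forces \<open>\<xi> = 0\<close> because \<open>df\<close> and \<open>dh\<close> are independent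
    (\<open>indecomposable_M_beta\<close>).

  \<^item> A local product structure yields a parallel symmetric bilinear form, the metric of the first
    factor pulled back (\<open>product_form_parallel\<close>). On this manifold every parallel symmetric form is a multiple of the metric
    (\<open>parallel_form_M_beta\<close>), whereas the pulled back form is neither zero nor positive definite.

  \<^item> The function \<open>s = f h\<close> is \<open>- 2 / \<tau>\<close>, hence preserved by local isometries, and so are
    \<open>q = \<bar>grad s\<bar>\<^sup>2 / s\<close> and \<open>dq (grad s)\<close>. With \<open>r = h / f\<close> and \<open>c = 1 + \<beta>\<^sup>2\<close> one finds \<open>q - 2 = r + c / r\<close> and
    \<open>dq (grad s) = - (r - c / r)\<^sup>2\<close>, so that \<open>dq (grad s) + (q - 2)\<^sup>2 = 4 (1 + \<beta>\<^sup>2)\<close>: the parameter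
    is a local isometry invariant (\<open>beta_invariant\<close>).

  The last two points rest on the behaviour of the Levi-Civita connection and of its curvature under
  isometries, which is derived from the Koszul formula and the symmetry of the second and third derivatives of
  the isometry.
\<close>

section \<open>Symmetry of second derivatives and product rules\<close>

text \<open>
  Young's form of the symmetry of second derivatives, a statement about the single point \<open>x\<close>.
  The second
  difference quotient over a shrinking parallelogram is symmetric in \<open>u\<close> and
  \<open>v\<close>, and the mean value theorem in the direction \<open>u\<close> identifies its
  limit as the derivative along \<open>v\<close> of the derivative along \<open>u\<close>.
\<close>

lemma mixed_difference_tendsto:
  fixes F :: "'a::real_normed_vector \<Rightarrow> real"
  assumes S: "open S" "x \<in> S"
    and F: "\<And>y. y \<in> S \<Longrightarrow> (F has_derivative F' y) (at y)"
    and G: "((\<lambda>y. F' y u) has_derivative G') (at x)"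
  shows "((\<lambda>t. (F (x + t *\<^sub>R u + t *\<^sub>R v) - F (x + t *\<^sub>R u) - F (x + t *\<^sub>R v) + F x) / t\<^sup>2)
           \<longlongrightarrow> G' v) (at_right (0::real))"
proof (rule tendstoI)
  fix e :: real assume e: "e > 0"
  let ?N = "2 * norm u + norm v + 1"
  have N: "?N > 0" by (simp add: add_nonneg_pos)
  define e' where "e' = e / (2 * ?N)"
  have e': "e' > 0" using e N by (simp add: e'_def)
  obtain d0 where d0: "d0 > 0" and dG: "\<And>y. norm (y - x) < d0 \<Longrightarrow>
      norm (F' y u - F' x u - G' (y - x)) \<le> e' * norm (y - x)"
    using G e' unfolding has_derivative_at_alt by blast
  obtain r where r: "r > 0" "ball x r \<subseteq> S" using S openE by blast
  interpret G': bounded_linear G' using G by (rule has_derivative_bounded_linear)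
  define d where "d = min d0 r / ?N"
  have d: "d > 0" using d0 r N by (simp add: d_def)
  have "dist ((F (x + t *\<^sub>R u + t *\<^sub>R v) - F (x + t *\<^sub>R u) - F (x + t *\<^sub>R v) + F x) / t\<^sup>2) (G' v) < e"
    if t: "0 < t" "t < d" for t
  proof -
    have tN: "t * ?N < min d0 r"
      using t N by (simp add: d_def pos_less_divide_eq)
    have near: "norm (a *\<^sub>R u + b *\<^sub>R v) < min d0 r" if "0 \<le> a" "a \<le> t" "0 \<le> b" "b \<le> t" for a b
    proof -
      have "norm (a *\<^sub>R u + b *\<^sub>R v) \<le> a * norm u + b * norm v"
        using norm_triangle_ineq[of "a *\<^sub>R u" "b *\<^sub>R v"] that by simp
      also have "\<dots> \<le> t * norm u + t * norm v"
        using that by (intro add_mono mult_right_mono) auto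
      also have "\<dots> \<le> t * ?N"
        using t by (simp add: algebra_simps)
      finally show ?thesis using tN by simp
    qed
    have inS: "x + a *\<^sub>R u + b *\<^sub>R v \<in> S" if "0 \<le> a" "a \<le> t" "0 \<le> b" "b \<le> t" for a b
      using near[OF that] r by (auto simp: subset_iff dist_norm add.assoc norm_minus_commute)
    define p where "p s = F (x + s *\<^sub>R u + t *\<^sub>R v) - F (x + s *\<^sub>R u)" for s
    have dp: "(p has_real_derivative F' (x + s *\<^sub>R u + t *\<^sub>R v) u - F' (x + s *\<^sub>R u) u) (at s)"
      if "0 \<le> s" "s \<le> t" for s
    proof -
      have lin: "F' y (a *\<^sub>R u) = a * F' y u" if "y \<in> S" for y a
        using linear_cmul[OF has_derivative_linear[OF F[OF that]], of a u] by simp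
      have 1: "x + s *\<^sub>R u + t *\<^sub>R v \<in> S" "x + s *\<^sub>R u \<in> S"
        using inS[of s t] inS[of s 0] that t by auto
      have "((\<lambda>s. F (x + s *\<^sub>R u + t *\<^sub>R v)) has_derivative (\<lambda>a. F' (x + s *\<^sub>R u + t *\<^sub>R v) (a *\<^sub>R u))) (at s)"
        by (rule has_derivative_compose[of "\<lambda>s. x + s *\<^sub>R u + t *\<^sub>R v", OF _ F[OF 1(1)]])
          (auto intro!: derivative_eq_intros)
      moreover have "((\<lambda>s. F (x + s *\<^sub>R u)) has_derivative (\<lambda>a. F' (x + s *\<^sub>R u) (a *\<^sub>R u))) (at s)"
        by (rule has_derivative_compose[of "\<lambda>s. x + s *\<^sub>R u", OF _ F[OF 1(2)]])
          (auto intro!: derivative_eq_intros)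
      ultimately have "(p has_derivative
          (\<lambda>a. F' (x + s *\<^sub>R u + t *\<^sub>R v) (a *\<^sub>R u) - F' (x + s *\<^sub>R u) (a *\<^sub>R u))) (at s)"
        unfolding p_def by (rule has_derivative_diff)
      then show ?thesis
        unfolding has_field_derivative_def
        by (rule has_derivative_eq_rhs) (simp add: lin 1 fun_eq_iff mult.commute right_diff_distrib)
    qed
    \<comment> \<open>The mean value theorem in the direction \<open>u\<close> only; the increment along
        \<open>v\<close> is controlled by the derivative \<open>G'\<close>.\<close>
    obtain z where z: "0 < z" "z < t"
      and pz: "p t - p 0 = (t - 0) * (F' (x + z *\<^sub>R u + t *\<^sub>R v) u - F' (x + z *\<^sub>R u) u)"
      using MVT2[of 0 t p "\<lambda>s. F' (x + s *\<^sub>R u + t *\<^sub>R v) u - F' (x + s *\<^sub>R u) u"] dp t by auto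
    define E where "E y = F' y u - F' x u - G' (y - x)" for y
    have E1: "norm (E (x + z *\<^sub>R u + b *\<^sub>R v)) \<le> e' * (z * norm u + b * norm v)" if "0 \<le> b" "b \<le> t" for b
    proof -
      have eq: "x + z *\<^sub>R u + b *\<^sub>R v - x = z *\<^sub>R u + b *\<^sub>R v" by simp
      have "norm (E (x + z *\<^sub>R u + b *\<^sub>R v)) \<le> e' * norm (z *\<^sub>R u + b *\<^sub>R v)"
        using dG[of "x + z *\<^sub>R u + b *\<^sub>R v"] near[of z b] that z unfolding E_def eq by auto
      also have "\<dots> \<le> e' * (z * norm u + b * norm v)"
        using norm_triangle_ineq[of "z *\<^sub>R u" "b *\<^sub>R v"] that z e' by (intro mult_left_mono) auto
      finally show ?thesis .
    qed
    have "p t - p 0 = t * (t * G' v + (E (x + z *\<^sub>R u + t *\<^sub>R v) - E (x + z *\<^sub>R u)))"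
      unfolding pz E_def by (simp add: G'.add G'.diff G'.scaleR)
    then have "(p t - p 0) / t\<^sup>2 - G' v = t * (t * G' v + (E (x + z *\<^sub>R u + t *\<^sub>R v) - E (x + z *\<^sub>R u))) / t\<^sup>2 - G' v"
      by simp
    also have "\<dots> = (E (x + z *\<^sub>R u + t *\<^sub>R v) - E (x + z *\<^sub>R u)) / t"
      using t by (simp add: add_divide_distrib power2_eq_square)
    also have "norm \<dots> \<le> (e' * (z * norm u + t * norm v) + e' * (z * norm u)) / t"
      using E1[of t] E1[of 0] t norm_triangle_ineq4[of "E (x + z *\<^sub>R u + t *\<^sub>R v)" "E (x + z *\<^sub>R u)"]
      by (simp add: divide_right_mono)
    also have "\<dots> \<le> (e' * (t * norm u + t * norm v) + e' * (t * norm u)) / t"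
      using z t e' by (intro divide_right_mono add_mono mult_left_mono mult_right_mono) auto
    also have "\<dots> = e' * (2 * norm u + norm v)"
      using t by (simp add: field_simps)
    also have "\<dots> < e' * (2 * ?N)" using e' N by (intro mult_strict_left_mono) auto
    also have "\<dots> = e" using N by (simp add: e'_def field_simps)
    finally show ?thesis
      unfolding p_def by (simp add: dist_norm algebra_simps)
  qed
  then show "\<forall>\<^sub>F t in at_right 0. dist ((F (x + t *\<^sub>R u + t *\<^sub>R v) - F (x + t *\<^sub>R u)
      - F (x + t *\<^sub>R v) + F x) / t\<^sup>2) (G' v) < e"
    unfolding eventually_at_right_field using d by auto
qed

lemma second_derivative_symmetric_real:
  fixes F :: "'a::real_normed_vector \<Rightarrow> real"
  assumes S: "open S" "x \<in> S"
    and F: "\<And>y. y \<in> S \<Longrightarrow> (F has_derivative F' y) (at y)"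
    and G: "((\<lambda>y. F' y u) has_derivative G') (at x)"
    and H: "((\<lambda>y. F' y v) has_derivative H') (at x)"
  shows "G' v = H' u"
proof -
  have "(\<lambda>t. (F (x + t *\<^sub>R u + t *\<^sub>R v) - F (x + t *\<^sub>R u) - F (x + t *\<^sub>R v) + F x) / t\<^sup>2)
      = (\<lambda>t. (F (x + t *\<^sub>R v + t *\<^sub>R u) - F (x + t *\<^sub>R v) - F (x + t *\<^sub>R u) + F x) / t\<^sup>2)"
    by (simp add: algebra_simps)
  then show ?thesis
    using mixed_difference_tendsto[OF S F G, of v] mixed_difference_tendsto[OF S F H, of u]
    by (auto intro: tendsto_unique[OF trivial_limit_at_right_real])
qed

lemma second_derivative_symmetric:
  fixes F :: "'a::real_normed_vector \<Rightarrow> 'b::euclidean_space"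
  assumes S: "open S" "x \<in> S"
    and F: "\<And>y. y \<in> S \<Longrightarrow> F differentiable (at y)"
    and D: "\<And>u. (\<lambda>y. frechet_derivative F (at y) u) differentiable (at x)"
  shows "frechet_derivative (\<lambda>y. frechet_derivative F (at y) u) (at x) v
       = frechet_derivative (\<lambda>y. frechet_derivative F (at y) v) (at x) u"
proof (rule euclidean_eqI)
  fix b :: 'b
  have 1: "((\<lambda>y. F y \<bullet> b) has_derivative (\<lambda>h. frechet_derivative F (at y) h \<bullet> b)) (at y)"
    if "y \<in> S" for y
    using F[OF that] unfolding frechet_derivative_works by (rule has_derivative_inner_left)
  have 2: "((\<lambda>y. frechet_derivative F (at y) u \<bullet> b) has_derivative
     (\<lambda>h. frechet_derivative (\<lambda>y. frechet_derivative F (at y) u) (at x) h \<bullet> b)) (at x)" for u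
    using D[of u] unfolding frechet_derivative_works by (rule has_derivative_inner_left)
  show "frechet_derivative (\<lambda>y. frechet_derivative F (at y) u) (at x) v \<bullet> b
      = frechet_derivative (\<lambda>y. frechet_derivative F (at y) v) (at x) u \<bullet> b"
    by (rule second_derivative_symmetric_real[OF S 1 2 2])
qed

text \<open>
  A product rule that needs only derivatives of \<open>L y v\<close> for each fixed
  \<open>v\<close>. Derivatives of maps, metrics and connections come in this form; finite
  dimension makes it sufficient, through the expansion of the argument in a basis.
\<close>

lemma has_derivative_linear_family:
  fixes L :: "'a::real_normed_vector \<Rightarrow> 'b::euclidean_space \<Rightarrow> 'c::real_normed_vector"
  assumes S: "open S" "x \<in> S"
    and lin: "\<And>y. y \<in> S \<Longrightarrow> linear (L y)"
    and L: "\<And>v. ((\<lambda>y. L y v) has_derivative (\<lambda>h. L' h v)) (at x)"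
    and A: "(A has_derivative A') (at x)"
  shows "((\<lambda>y. L y (A y)) has_derivative (\<lambda>h. L' h (A x) + L x (A' h))) (at x)"
proof -
  have rep: "L y w = (\<Sum>b\<in>Basis. (w \<bullet> b) *\<^sub>R L y b)" if "y \<in> S" for y w
  proof -
    have "L y w = L y (\<Sum>b\<in>Basis. (w \<bullet> b) *\<^sub>R b)" by (simp add: euclidean_representation)
    also have "\<dots> = (\<Sum>b\<in>Basis. (w \<bullet> b) *\<^sub>R L y b)"
      using lin[OF that] by (simp add: linear_sum linear_cmul)
    finally show ?thesis .
  qed
  have rep': "L' h w = (\<Sum>b\<in>Basis. (w \<bullet> b) *\<^sub>R L' h b)" for h w
  proof -
    have "((\<lambda>y. L y w) has_derivative (\<lambda>h. \<Sum>b\<in>Basis. (w \<bullet> b) *\<^sub>R L' h b)) (at x)"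
      by (rule has_derivative_transform_within_open[OF _ S, of "\<lambda>y. \<Sum>b\<in>Basis. (w \<bullet> b) *\<^sub>R L y b"])
        (auto intro!: derivative_eq_intros L simp: rep)
    from has_derivative_unique[OF this L[of w]] show ?thesis by (simp add: fun_eq_iff)
  qed
  have "((\<lambda>y. \<Sum>b\<in>Basis. (A y \<bullet> b) *\<^sub>R L y b) has_derivative
      (\<lambda>h. \<Sum>b\<in>Basis. (A x \<bullet> b) *\<^sub>R L' h b + (A' h \<bullet> b) *\<^sub>R L x b)) (at x)"
    by (intro has_derivative_sum has_derivative_scaleR L has_derivative_inner_left A)
  also have "(\<lambda>h. \<Sum>b\<in>Basis. (A x \<bullet> b) *\<^sub>R L' h b + (A' h \<bullet> b) *\<^sub>R L x b)
      = (\<lambda>h. L' h (A x) + L x (A' h))"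
    by (subst rep[OF S(2)], subst rep'[of _ "A x"]) (simp add: sum.distrib)
  finally show ?thesis
    by (rule has_derivative_transform_within_open[OF _ S]) (simp add: rep)
qed

lemma has_derivative_bilinear_family:
  fixes L :: "'a::real_normed_vector \<Rightarrow> 'b::euclidean_space \<Rightarrow> 'c::euclidean_space \<Rightarrow> 'd::real_normed_vector"
  assumes S: "open S" "x \<in> S"
    and bil: "\<And>y. y \<in> S \<Longrightarrow> bilinear (L y)"
    and L: "\<And>v w. ((\<lambda>y. L y v w) has_derivative (\<lambda>h. L' h v w)) (at x)"
    and A: "(A has_derivative A') (at x)"
    and B: "(B has_derivative B') (at x)"
  shows "((\<lambda>y. L y (A y) (B y)) has_derivative
      (\<lambda>h. L' h (A x) (B x) + L x (A' h) (B x) + L x (A x) (B' h))) (at x)"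
proof -
  have "((\<lambda>y. L y (A y) w) has_derivative (\<lambda>h. L' h (A x) w + L x (A' h) w)) (at x)" for w
    by (rule has_derivative_linear_family[where L = "\<lambda>y v. L y v w", OF S _ L A])
      (use bil in \<open>auto simp: bilinear_def\<close>)
  from has_derivative_linear_family[where L = "\<lambda>y. L y (A y)", OF S _ this B] bil
  show ?thesis by (auto simp: bilinear_def)
qed

section \<open>Closure properties of functions of class \<open>C\<^sup>k\<close>\<close>

text \<open>
  The iterated derivatives see only the germ of the function, so \<open>Ck_on\<close> on an open
  set depends only on the values there. The closure properties below need this, since the
  derivative of a sum or a product is known only at the points of the open set.
\<close>

lemma Ck_on_cong:
  assumes "open S" "\<And>x. x \<in> S \<Longrightarrow> f x = g x" "Ck_on k S f"
  shows "Ck_on k S g"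
  using assms(2,3)
proof (induction k arbitrary: f g)
  case 0
  then show ?case by (metis Ck_on.simps(1) continuous_on_cong)
next
  case (Suc k)
  have D: "(g has_derivative frechet_derivative f (at x)) (at x)" if "x \<in> S" for x
    using Suc.prems that assms(1)
    by (auto intro: has_derivative_transform_within_open simp: frechet_derivative_works)
  have "Ck_on k S (\<lambda>x. frechet_derivative g (at x) v)" for v
    by (rule Suc.IH[of "\<lambda>x. frechet_derivative f (at x) v"])
      (use Suc.prems frechet_derivative_at[OF D] in auto)
  then show ?case using D by (auto simp: differentiable_def)
qed

lemma Ck_on_const: "Ck_on k S (\<lambda>x. c)"
  by (induction k arbitrary: c) auto

lemma Ck_on_bounded_linear:
  assumes "bounded_linear f"
  shows "Ck_on k S f"
proof -
  have "frechet_derivative f (at x) = f" for x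
    using frechet_derivative_at[OF bounded_linear_imp_has_derivative[OF assms]] by metis
  then show ?thesis
    using assms by (cases k)
      (auto simp: linear_continuous_on bounded_linear_imp_differentiable Ck_on_const)
qed

lemma Ck_on_SucD: "Ck_on (Suc k) S f \<Longrightarrow> Ck_on k S f"
  by (induction k arbitrary: f)
    (auto intro!: differentiable_imp_continuous_on simp: differentiable_on_def differentiable_at_withinI)

lemma Ck_on_add:
  assumes "open S" "Ck_on k S f" "Ck_on k S g"
  shows "Ck_on k S (\<lambda>x. f x + g x)"
  using assms(2,3)
proof (induction k arbitrary: f g)
  case 0
  then show ?case by (auto intro: continuous_on_add)
next
  case (Suc k)
  have D: "((\<lambda>x. f x + g x) has_derivative
      (\<lambda>v. frechet_derivative f (at x) v + frechet_derivative g (at x) v)) (at x)" if "x \<in> S" for x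
    using Suc.prems that by (auto intro!: has_derivative_add simp: frechet_derivative_works)
  have "Ck_on k S (\<lambda>x. frechet_derivative (\<lambda>x. f x + g x) (at x) v)" for v
    by (rule Ck_on_cong[OF assms(1) _ Suc.IH])
      (use Suc.prems in \<open>auto simp: frechet_derivative_at[OF D, symmetric]\<close>)
  then show ?case using D by (auto simp: differentiable_def)
qed

lemma Ck_on_mult:
  fixes f g :: "'a::euclidean_space \<Rightarrow> real"
  assumes "open S" "Ck_on k S f" "Ck_on k S g"
  shows "Ck_on k S (\<lambda>x. f x * g x)"
  using assms(2,3)
proof (induction k arbitrary: f g)
  case 0
  then show ?case by (auto intro: continuous_on_mult)
next
  case (Suc k)
  have D: "((\<lambda>x. f x * g x) has_derivative
      (\<lambda>v. f x * frechet_derivative g (at x) v + frechet_derivative f (at x) v * g x)) (at x)"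
    if "x \<in> S" for x
    using Suc.prems that by (auto intro!: has_derivative_mult simp: frechet_derivative_works)
  have "Ck_on k S (\<lambda>x. frechet_derivative (\<lambda>x. f x * g x) (at x) v)" for v
    by (rule Ck_on_cong[OF assms(1) _ Ck_on_add[OF assms(1) 
        Suc.IH[of f "\<lambda>x. frechet_derivative g (at x) v"]
        Suc.IH[of "\<lambda>x. frechet_derivative f (at x) v" g]]])
      (use Suc.prems Ck_on_SucD[OF Suc.prems(1)] Ck_on_SucD[OF Suc.prems(2)]
        in \<open>auto simp: frechet_derivative_at[OF D, symmetric]\<close>)
  then show ?case using D by (auto simp: differentiable_def)
qed

section \<open>Inner products on a Euclidean space\<close>

text \<open>
  The tangent spaces carry inner products other than the ambient one, so duality, orthonormal
  bases and Parseval's identity are developed for an arbitrary positive definite form.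
\<close>

locale inner_form =
  fixes ip :: "'a::euclidean_space \<Rightarrow> 'a \<Rightarrow> real"
  assumes bilinear: "bilinear ip"
    and sym: "ip u v = ip v u"
    and pos: "u \<noteq> 0 \<Longrightarrow> ip u u > 0"
begin

lemmas simps [simp] = bilinear_ladd[OF bilinear] bilinear_radd[OF bilinear]
  bilinear_lsub[OF bilinear] bilinear_rsub[OF bilinear]
  bilinear_lmul[OF bilinear] bilinear_rmul[OF bilinear]
  bilinear_lzero[OF bilinear] bilinear_rzero[OF bilinear]
  bilinear_lneg[OF bilinear] bilinear_rneg[OF bilinear]

lemma nonneg: "ip u u \<ge> 0"
  using pos[of u] by (cases "u = 0") auto

lemma eqI: "(\<And>z. ip u z = ip v z) \<Longrightarrow> u = v"
  using pos[of "u - v"] by force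

lemma sum_left: "ip (\<Sum>i\<in>I. f i) w = (\<Sum>i\<in>I. ip (f i) w)"
  using bilinear by (auto simp: bilinear_def linear_sum[where f = "\<lambda>u. ip u w"])

lemma sharp_eqI:
  assumes "\<And>z. ip w z = \<alpha> z"
  shows "sharp ip \<alpha> = w"
  unfolding sharp_def by (rule the_equality) (use assms in \<open>auto intro: eqI\<close>)

text \<open>
  A positive definite form induces an injective, hence surjective, map to the coordinate space, so
  that every linear form has a dual vector.
\<close>

lemma sharp:
  assumes "linear \<alpha>"
  shows "ip (sharp ip \<alpha>) z = \<alpha> z"
proof -
  define f where "f w = (\<Sum>b\<in>Basis. ip w b *\<^sub>R b)" for w
  have "linear f"
    unfolding f_def by (rule linearI) (simp_all add: algebra_simps sum.distrib scaleR_right.sum)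
  moreover have "inj f"
  proof (rule linear_injective_0[THEN iffD2, OF \<open>linear f\<close>, rule_format])
    fix w assume "f w = 0"
    then have 0: "ip w b = 0" if "b \<in> Basis" for b
      unfolding f_def using that by (metis inner_sum_left_Basis inner_zero_left)
    have "ip w z = ip 0 z" for z
    proof -
      have "ip w z = ip w (\<Sum>b\<in>Basis. (z \<bullet> b) *\<^sub>R b)" by (simp add: euclidean_representation)
      also have "\<dots> = (\<Sum>b\<in>Basis. (z \<bullet> b) *\<^sub>R ip w b)"
        unfolding sym[of w] sum_left by simp
      finally show ?thesis by (simp add: 0)
    qed
    then show "w = 0" by (rule eqI)
  qed
  ultimately have "surj f" by (simp add: linear_injective_imp_surjective)
  then obtain w where w: "f w = (\<Sum>b\<in>Basis. \<alpha> b *\<^sub>R b)" by (metis surjD)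
  have b: "ip w b = \<alpha> b" if "b \<in> Basis" for b
    using arg_cong[OF w, of "\<lambda>v. v \<bullet> b"] that by (simp add: f_def inner_sum_left_Basis)
  have "ip w z = \<alpha> z" for z
  proof -
    have "ip w z = ip w (\<Sum>b\<in>Basis. (z \<bullet> b) *\<^sub>R b)" by (simp add: euclidean_representation)
    also have "\<dots> = (\<Sum>b\<in>Basis. (z \<bullet> b) *\<^sub>R ip w b)"
      unfolding sym[of w] sum_left by simp
    also have "\<dots> = \<alpha> (\<Sum>b\<in>Basis. (z \<bullet> b) *\<^sub>R b)"
      using assms by (simp add: linear_sum linear_cmul b)
    finally show ?thesis by (simp add: euclidean_representation)
  qed
  then show ?thesis by (metis sharp_eqI)
qed

definition orthonormal :: "'a set \<Rightarrow> bool" where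
  "orthonormal B \<longleftrightarrow> (\<forall>u\<in>B. \<forall>v\<in>B. ip u v = (if u = v then 1 else 0))"

lemma orthonormal_expand:
  assumes "finite B" "orthonormal B" "w \<in> span B"
  shows "w = (\<Sum>v\<in>B. ip w v *\<^sub>R v)"
proof -
  obtain c where w: "w = (\<Sum>v\<in>B. c v *\<^sub>R v)"
    using assms by (auto simp: span_finite)
  have "ip w v = c v" if "v \<in> B" for v
  proof -
    have "ip w v = (\<Sum>u\<in>B. c u * ip u v)" by (simp add: w sum_left)
    also have "\<dots> = (\<Sum>u\<in>B. if u = v then c u else 0)"
      using assms that by (intro sum.cong) (auto simp: orthonormal_def)
    finally show ?thesis using assms that by simp
  qed
  then show ?thesis using w by simp
qed

lemma residue_orthogonal:
  assumes "finite B" "orthonormal B" "u \<in> span B"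
  shows "ip (w - (\<Sum>v\<in>B. ip w v *\<^sub>R v)) u = 0"
proof -
  have v: "ip (w - (\<Sum>v\<in>B. ip w v *\<^sub>R v)) b = 0" if "b \<in> B" for b
  proof -
    have "(\<Sum>v\<in>B. ip w v * ip v b) = (\<Sum>v\<in>B. if v = b then ip w v else 0)"
      using assms that by (intro sum.cong) (auto simp: orthonormal_def)
    then show ?thesis using assms that by (simp add: sum_left)
  qed
  have "subspace {u. ip (w - (\<Sum>v\<in>B. ip w v *\<^sub>R v)) u = 0}"
    unfolding subspace_def by (simp del: simps(3))
  then have "span B \<subseteq> {u. ip (w - (\<Sum>v\<in>B. ip w v *\<^sub>R v)) u = 0}"
    using v by (intro span_minimal) auto
  then show ?thesis using assms by auto
qed

text \<open>
  One step of the Gram--Schmidt process: subtract the expansion in the orthonormal set found so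
  far and normalise, unless nothing remains.
\<close>

lemma gram_schmidt:
  assumes "finite S"
  shows "\<exists>B. finite B \<and> orthonormal B \<and> span B = span S"
  using assms
proof (induction S)
  case empty
  show ?case by (rule exI[of _ "{}"]) (simp add: orthonormal_def)
next
  case (insert x S)
  then obtain B where B: "finite B" "orthonormal B" "span B = span S" by blast
  define p where "p = (\<Sum>v\<in>B. ip x v *\<^sub>R v)"
  have p: "p \<in> span B" unfolding p_def by (intro span_sum span_scale span_base)
  have ins: "span (insert x S) = span (insert x B)"
    using B by (metis span_insert)
  have perp: "ip (x - p) u = 0" if "u \<in> B" for u
    unfolding p_def using B that by (intro residue_orthogonal) (auto intro: span_base)
  show ?case
  proof (cases "x = p")
    case True
    then have "span (insert x B) = span B" using p by (simp add: span_redundant)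
    then show ?thesis using B ins by auto
  next
    case False
    define r where "r = sqrt (ip (x - p) (x - p))"
    define e where "e = (1 / r) *\<^sub>R (x - p)"
    have r: "r > 0" "r * r = ip (x - p) (x - p)"
      using False pos[of "x - p"] nonneg[of "x - p"] by (auto simp: r_def simp del: simps(3,4))
    have "ip e e = (1 / r) * ((1 / r) * (r * r))" unfolding r(2) e_def by (simp del: simps(3,4))
    then have e1: "ip e e = 1" using r(1) by simp
    have e2: "ip e u = 0" if "u \<in> B" for u
      using perp[OF that] by (simp add: e_def del: simps(3,4))
    have x: "x = p + r *\<^sub>R e"
      unfolding e_def using r(1) by simp
    have "e \<in> span (insert x B)"
      unfolding e_def using p by (intro span_scale span_diff)
        (auto intro: span_base span_mono[THEN subsetD, of B])
    moreover have "x \<in> span (insert e B)"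
      by (subst x, rule span_add[OF _ span_scale])
        (use p span_mono[of B "insert e B"] in \<open>auto intro: span_base\<close>)
    ultimately have "span (insert e B) = span (insert x B)"
      using span_mono[of B "insert x B"] span_mono[of B "insert e B"]
      by (intro subset_antisym span_minimal) (auto intro: span_base simp: subspace_span)
    moreover have "orthonormal (insert e B)"
      using B e1 e2 sym[of e] unfolding orthonormal_def by (metis insert_iff zero_neq_one)
    ultimately show ?thesis using B ins by (metis finite.insertI)
  qed
qed

lemma orthonormal_basis_exists:
  assumes "subspace W"
  shows "\<exists>B. orthonormal_basis_of ip B W"
proof -
  obtain S where "finite S" "span S = W"
    using assms by (metis basis_subspace_exists)
  then show ?thesis
    using gram_schmidt[of S] unfolding orthonormal_basis_of_def orthonormal_def by auto
qed

lemma orthonormal_basis_parseval: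
  assumes "orthonormal_basis_of ip B UNIV"
  shows "(\<Sum>v\<in>B. ip a v * ip b v) = ip a b"
proof -
  have "a = (\<Sum>v\<in>B. ip a v *\<^sub>R v)"
    using assms by (intro orthonormal_expand) (auto simp: orthonormal_basis_of_def orthonormal_def)
  then have "ip a b = ip (\<Sum>v\<in>B. ip a v *\<^sub>R v) b" by simp
  then show ?thesis by (simp add: sum_left sym[of b])
qed

lemma orthonormal_basis_Un_orth_compl:
  assumes B: "orthonormal_basis_of ip B W" and C: "orthonormal_basis_of ip C (orth_compl ip W)"
  shows "orthonormal_basis_of ip (B \<union> C) UNIV" "B \<inter> C = {}"
proof -
  have 0: "ip u v = 0" "ip v u = 0" if "u \<in> B" "v \<in> C" for u v
    using that span_base[of u B] span_base[of v C] B C sym[of u v]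
    by (auto simp: orthonormal_basis_of_def orth_compl_def)
  then show "B \<inter> C = {}"
    using B unfolding orthonormal_basis_of_def by (metis disjoint_iff zero_neq_one)
  have "w \<in> span (B \<union> C)" for w
  proof -
    define p where "p = (\<Sum>v\<in>B. ip w v *\<^sub>R v)"
    have "p \<in> span B" unfolding p_def by (intro span_sum span_scale span_base)
    moreover have "w - p \<in> span C"
      using B C residue_orthogonal[of B _ w]
      by (auto simp: orthonormal_basis_of_def orthonormal_def orth_compl_def p_def)
    ultimately have "p \<in> span (B \<union> C)" "w - p \<in> span (B \<union> C)"
      using span_mono[of B "B \<union> C"] span_mono[of C "B \<union> C"] by auto
    from span_add[OF this] show ?thesis by simp
  qed
  then show "orthonormal_basis_of ip (B \<union> C) UNIV"
    using B C 0 unfolding orthonormal_basis_of_def by (auto split: if_splits)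
qed

end

section \<open>The Levi-Civita connection of a chart\<close>

text \<open>
  The Koszul formula involves first derivatives of the metric. This regularity passes to Riemannian
  products by differentiating each summand separately, with no argument about smooth functions of
  several variables.
\<close>

locale C1_riemannian =
  fixes M :: "'a::euclidean_space riem"
  assumes open_points: "open (points M)"
    and metric_differentiable: "x \<in> points M \<Longrightarrow> (\<lambda>y. metric M y u v) differentiable (at x)"
    and inner_form_metric: "x \<in> points M \<Longrightarrow> inner_form (metric M x)"
begin

abbreviation dmetric :: "'a \<Rightarrow> 'a \<Rightarrow> 'a \<Rightarrow> 'a \<Rightarrow> real" where
  "dmetric x h u v \<equiv> frechet_derivative (\<lambda>y. metric M y u v) (at x) h"

lemma has_dmetric:
  "x \<in> points M \<Longrightarrow> ((\<lambda>y. metric M y u v) has_derivative (\<lambda>h. dmetric x h u v)) (at x)"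
  using metric_differentiable by (simp add: frechet_derivative_works)

lemma metric_bilinear: "x \<in> points M \<Longrightarrow> bilinear (metric M x)"
  using inner_form.bilinear inner_form_metric by auto

lemma metric_sym: "x \<in> points M \<Longrightarrow> metric M x u v = metric M x v u"
  using inner_form.sym inner_form_metric by auto

lemma dmetric_linear_dir: "x \<in> points M \<Longrightarrow> linear (\<lambda>h. dmetric x h u v)"
  using has_derivative_linear[OF has_dmetric] .

lemma dmetric_sym: "x \<in> points M \<Longrightarrow> dmetric x h u v = dmetric x h v u"
  using frechet_derivative_transform_within_open[OF _ open_points, of "\<lambda>y. metric M y u v" x
      "\<lambda>y. metric M y v u"] metric_sym metric_differentiable by metis

lemma dmetric_linear_right:
  assumes x: "x \<in> points M"
  shows "linear (\<lambda>v. dmetric x h u v)"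
proof (rule linearI)
  fix v w
  have "((\<lambda>y. metric M y u (v + w)) has_derivative (\<lambda>h. dmetric x h u v + dmetric x h u w)) (at x)"
    by (rule has_derivative_transform_within_open[OF _ open_points x,
          of "\<lambda>y. metric M y u v + metric M y u w"])
      (auto intro!: has_derivative_add has_dmetric x simp: bilinear_radd[OF metric_bilinear])
  from has_derivative_unique[OF has_dmetric[OF x] this]
  show "dmetric x h u (v + w) = dmetric x h u v + dmetric x h u w" by metis
next
  fix c v
  have "((\<lambda>y. metric M y u (c *\<^sub>R v)) has_derivative (\<lambda>h. c *\<^sub>R dmetric x h u v)) (at x)"
    by (rule has_derivative_transform_within_open[OF _ open_points x,
          of "\<lambda>y. c *\<^sub>R metric M y u v"], rule has_derivative_scaleR_right[OF has_dmetric[OF x]])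
      (simp add: bilinear_rmul[OF metric_bilinear])
  from has_derivative_unique[OF has_dmetric[OF x] this]
  show "dmetric x h u (c *\<^sub>R v) = c *\<^sub>R dmetric x h u v" by metis
qed

lemma dmetric_linear_left:
  assumes "x \<in> points M"
  shows "linear (\<lambda>u. dmetric x h u v)"
proof -
  have "(\<lambda>u. dmetric x h u v) = (\<lambda>u. dmetric x h v u)"
    using dmetric_sym[OF assms] by blast
  then show ?thesis using dmetric_linear_right[OF assms] by metis
qed

definition koszul :: "'a \<Rightarrow> 'a \<Rightarrow> 'a \<Rightarrow> 'a \<Rightarrow> real" where
  "koszul x u v z = (dmetric x u v z + dmetric x v u z - dmetric x z u v) / 2"

lemma christoffel_koszul: "christoffel M x u v = sharp (metric M x) (koszul x u v)"
  unfolding christoffel_def koszul_def ..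

lemma koszul_linear:
  assumes "x \<in> points M"
  shows "linear (\<lambda>u. koszul x u v z)" "linear (\<lambda>v. koszul x u v z)" "linear (\<lambda>z. koszul x u v z)"
proof -
  note L = dmetric_linear_dir[OF assms] dmetric_linear_left[OF assms] dmetric_linear_right[OF assms]
  note s = L[THEN linear_add] L[THEN linear_cmul]
  show "linear (\<lambda>u. koszul x u v z)" "linear (\<lambda>v. koszul x u v z)" "linear (\<lambda>z. koszul x u v z)"
    by (rule linearI; simp add: koszul_def s field_simps)+
qed

lemma metric_christoffel:
  "x \<in> points M \<Longrightarrow> metric M x (christoffel M x u v) z = koszul x u v z"
  unfolding christoffel_koszul
  by (rule inner_form.sharp[OF inner_form_metric koszul_linear(3)])

lemma christoffel_eqI:
  "x \<in> points M \<Longrightarrow> (\<And>z. metric M x w z = koszul x u v z) \<Longrightarrow> christoffel M x u v = w"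
  unfolding christoffel_koszul by (rule inner_form.sharp_eqI[OF inner_form_metric])

lemma christoffel_bilinear:
  assumes x: "x \<in> points M"
  shows "bilinear (christoffel M x)"
proof -
  interpret g: inner_form "metric M x" by (rule inner_form_metric[OF x])
  note K = koszul_linear[OF x]
  note s = K[THEN linear_add] K[THEN linear_cmul] metric_christoffel[OF x]
  show ?thesis
    unfolding bilinear_def by (intro allI conjI linearI; rule g.eqI; simp only: s g.simps)
qed

lemma metric_compatible:
  assumes x: "x \<in> points M"
  shows "dmetric x u v z = metric M x (christoffel M x u v) z + metric M x v (christoffel M x u z)"
proof -
  have m: "metric M x v (christoffel M x u z) = koszul x u z v"
    by (metis metric_christoffel[OF x] metric_sym[OF x])
  have "koszul x u v z + koszul x u z v = dmetric x u v z"
  proof -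
    have d: "dmetric x u z v = dmetric x u v z" "dmetric x z u v = dmetric x z v u"
      "dmetric x v u z = dmetric x v z u"
      by (rule dmetric_sym[OF x])+
    have e: "(a + b - c) / 2 + (a + c - b) / 2 = a" for a b c :: real
      by (simp add: field_simps)
    show ?thesis unfolding koszul_def d by (rule e)
  qed
  then show ?thesis
    unfolding m metric_christoffel[OF x] by (rule HOL.sym)
qed

end

lemma riemannian_manifold_imp_C1: "riemannian_manifold M \<Longrightarrow> C1_riemannian M"
proof -
  assume M: "riemannian_manifold M"
  then have "Ck_on (Suc 0) (points M) (\<lambda>x. metric M x u v)" for u v
    unfolding riemannian_manifold_def smooth_on_def by blast
  then show ?thesis
    using M unfolding riemannian_manifold_def C1_riemannian_def inner_form_def by simp
qed

lemma C1_riemannian_open_part: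
  "C1_riemannian M \<Longrightarrow> open U \<Longrightarrow> U \<subseteq> points M \<Longrightarrow> C1_riemannian (open_part M U)"
  unfolding C1_riemannian_def open_part_def by auto

lemma christoffel_open_part [simp]: "christoffel (open_part M U) = christoffel M"
  by (simp add: christoffel_def open_part_def fun_eq_iff)

lemma riem_curvature_open_part [simp]: "riem_curvature (open_part M U) = riem_curvature M"
  by (simp add: riem_curvature_def fun_eq_iff)

lemma metric_open_part [simp]: "metric (open_part M U) = metric M"
  and points_open_part [simp]: "points (open_part M U) = U"
  by (simp_all add: open_part_def)

text \<open>
  The pair of the two connections solves the Koszul formula of the product metric, whose terms are
  sums of terms of the factors.
\<close>

lemma
  fixes M1 :: "'b::euclidean_space riem" and M2 :: "'c::euclidean_space riem"
  assumes "C1_riemannian M1" "C1_riemannian M2"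
  shows C1_riemannian_product: "C1_riemannian (riem_product M1 M2)"
    and christoffel_product: "x \<in> points (riem_product M1 M2) \<Longrightarrow>
      christoffel (riem_product M1 M2) x u v
        = (christoffel M1 (fst x) (fst u) (fst v), christoffel M2 (snd x) (snd u) (snd v))"
proof -
  interpret M1: C1_riemannian M1 by fact
  interpret M2: C1_riemannian M2 by fact
  let ?N = "riem_product M1 M2"
  have pts: "x \<in> points ?N \<longleftrightarrow> fst x \<in> points M1 \<and> snd x \<in> points M2" for x
    by (cases x) (simp add: riem_product_def)
  have met: "metric ?N x u v = metric M1 (fst x) (fst u) (fst v) + metric M2 (snd x) (snd u) (snd v)"
    for x u v by (simp add: riem_product_def)
  have D: "((\<lambda>x. metric ?N x u v) has_derivative (\<lambda>h. M1.dmetric (fst x) (fst h) (fst u) (fst v)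
      + M2.dmetric (snd x) (snd h) (snd u) (snd v))) (at x)" if "x \<in> points ?N" for x u v
    unfolding met
    using that has_derivative_compose[OF has_derivative_fst[OF has_derivative_ident] M1.has_dmetric, of x]
      has_derivative_compose[OF has_derivative_snd[OF has_derivative_ident] M2.has_dmetric, of x]
    by (intro has_derivative_add) (auto simp: pts)
  have form: "inner_form (metric ?N x)" if "x \<in> points ?N" for x
  proof -
    interpret g1: inner_form "metric M1 (fst x)" using that M1.inner_form_metric by (simp add: pts)
    interpret g2: inner_form "metric M2 (snd x)" using that M2.inner_form_metric by (simp add: pts)
    show ?thesis
    proof
      show "bilinear (metric ?N x)"
        unfolding bilinear_def by (intro allI conjI linearI; simp add: met algebra_simps)
      show "metric ?N x u v = metric ?N x v u" for u v
        by (simp add: met g1.sym[of "fst u"] g2.sym[of "snd u"])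
      show "metric ?N x u u > 0" if "u \<noteq> 0" for u
        using that g1.pos[of "fst u"] g2.pos[of "snd u"] g1.nonneg[of "fst u"] g2.nonneg[of "snd u"]
        by (cases "fst u = 0"; cases "snd u = 0") (auto simp: met prod_eq_iff)
    qed
  qed
  show N: "C1_riemannian ?N"
  proof (rule C1_riemannian.intro)
    show "open (points ?N)"
      using M1.open_points M2.open_points by (simp add: riem_product_def open_Times)
    show "(\<lambda>y. metric ?N y u v) differentiable (at x)" if "x \<in> points ?N" for x u v
      using D[OF that] unfolding differentiable_def by blast
  qed (rule form)
  then interpret N: C1_riemannian ?N .
  show "christoffel ?N x u v = (christoffel M1 (fst x) (fst u) (fst v), christoffel M2 (snd x) (snd u) (snd v))"
    if x: "x \<in> points ?N"
  proof (rule N.christoffel_eqI[OF x])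
    fix z
    have dN: "N.dmetric x h u v = M1.dmetric (fst x) (fst h) (fst u) (fst v)
      + M2.dmetric (snd x) (snd h) (snd u) (snd v)" for h u v
      using fun_cong[OF frechet_derivative_at[OF D[OF x]], symmetric] .
    have e: "(a + b - c) / 2 + (a' + b' - c') / 2 = ((a + a') + (b + b') - (c + c')) / 2"
      for a b c a' b' c' :: real by argo
    have x': "fst x \<in> points M1" "snd x \<in> points M2" using x by (simp_all add: pts)
    show "metric ?N x (christoffel M1 (fst x) (fst u) (fst v), christoffel M2 (snd x) (snd u) (snd v)) z
        = N.koszul x u v z"
      unfolding N.koszul_def dN
      unfolding met fst_conv snd_conv M1.metric_christoffel[OF x'(1)] M2.metric_christoffel[OF x'(2)]
        M1.koszul_def M2.koszul_def by (rule e)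
  qed
qed

section \<open>Naturality of connection and curvature under isometries\<close>

text \<open>
  A local isometry. Surjectivity of the differential lets a vector of \<open>N\<close> be tested
  against the images of vectors of \<open>M\<close>.
\<close>

locale riem_isometry = M: C1_riemannian M + N: C1_riemannian N
  for M :: "'a::euclidean_space riem" and N :: "'b::euclidean_space riem" +
  fixes \<phi> :: "'a \<Rightarrow> 'b"
  assumes maps: "x \<in> points M \<Longrightarrow> \<phi> x \<in> points N"
    and smooth: "smooth_on (points M) \<phi>"
    and surj_D: "x \<in> points M \<Longrightarrow> surj (frechet_derivative \<phi> (at x))"
    and isometry: "x \<in> points M \<Longrightarrow>
      metric N (\<phi> x) (frechet_derivative \<phi> (at x) u) (frechet_derivative \<phi> (at x) v) = metric M x u v"
begin

abbreviation D :: "'a \<Rightarrow> 'a \<Rightarrow> 'b" where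
  "D x u \<equiv> frechet_derivative \<phi> (at x) u"

abbreviation D2 :: "'a \<Rightarrow> 'a \<Rightarrow> 'a \<Rightarrow> 'b" where
  "D2 x u v \<equiv> frechet_derivative (\<lambda>y. D y v) (at x) u"

abbreviation D3 :: "'a \<Rightarrow> 'a \<Rightarrow> 'a \<Rightarrow> 'a \<Rightarrow> 'b" where
  "D3 x w u v \<equiv> frechet_derivative (\<lambda>y. D2 y u v) (at x) w"

lemma differentiable:
  assumes "x \<in> points M"
  shows "\<phi> differentiable (at x)" "(\<lambda>y. D y v) differentiable (at x)"
    "(\<lambda>y. D2 y u v) differentiable (at x)"
proof -
  have "Ck_on (Suc (Suc (Suc 0))) (points M) \<phi>"
    using smooth unfolding smooth_on_def by blast
  then show "\<phi> differentiable (at x)" "(\<lambda>y. D y v) differentiable (at x)"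
    "(\<lambda>y. D2 y u v) differentiable (at x)"
    using assms by simp_all
qed

lemma has_D: "x \<in> points M \<Longrightarrow> (\<phi> has_derivative D x) (at x)"
  and has_D2: "x \<in> points M \<Longrightarrow> ((\<lambda>y. D y v) has_derivative (\<lambda>u. D2 x u v)) (at x)"
  and has_D3: "x \<in> points M \<Longrightarrow> ((\<lambda>y. D2 y u v) has_derivative (\<lambda>w. D3 x w u v)) (at x)"
  using differentiable frechet_derivative_works by blast+

lemma D_linear: "x \<in> points M \<Longrightarrow> linear (D x)"
  using has_D has_derivative_linear by auto

lemma D2_sym: "x \<in> points M \<Longrightarrow> D2 x u v = D2 x v u"
  by (rule second_derivative_symmetric[OF M.open_points]) (use differentiable in auto)

lemma D3_sym: "x \<in> points M \<Longrightarrow> D3 x w u v = D3 x u w v"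
  by (rule second_derivative_symmetric[OF M.open_points]) (use differentiable in auto)

lemma D_eqI: "x \<in> points M \<Longrightarrow> (\<And>z. metric N (\<phi> x) u (D x z) = metric N (\<phi> x) v (D x z)) \<Longrightarrow> u = v"
  by (rule inner_form.eqI[OF N.inner_form_metric]) (use maps surj_D in \<open>auto, metis surjD\<close>)

lemma compose_has_derivative:
  assumes "x \<in> points M" "(f has_derivative f') (at (\<phi> x))"
  shows "((\<lambda>y. f (\<phi> y)) has_derivative (\<lambda>h. f' (D x h))) (at x)"
  using has_derivative_compose[OF has_D assms(2)] assms(1) by simp

text \<open>
  Differentiating the isometry equation brings in the second derivative of \<open>\<phi>\<close>,
  because the image of a constant vector field is not constant.
\<close>

lemma dmetric:
  assumes x: "x \<in> points M"
  shows "M.dmetric x w u v = N.dmetric (\<phi> x) (D x w) (D x u) (D x v)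
    + metric N (\<phi> x) (D2 x w u) (D x v) + metric N (\<phi> x) (D x u) (D2 x w v)"
proof -
  have "((\<lambda>y. metric N (\<phi> y) (D y u) (D y v)) has_derivative
     (\<lambda>w. N.dmetric (\<phi> x) (D x w) (D x u) (D x v)
    + metric N (\<phi> x) (D2 x w u) (D x v) + metric N (\<phi> x) (D x u) (D2 x w v))) (at x)"
    by (rule has_derivative_bilinear_family[where L = "\<lambda>y. metric N (\<phi> y)", OF M.open_points x])
      (use x maps in \<open>auto intro!: N.metric_bilinear compose_has_derivative N.has_dmetric has_D2\<close>)
  then have "((\<lambda>y. metric M y u v) has_derivative
     (\<lambda>w. N.dmetric (\<phi> x) (D x w) (D x u) (D x v)
    + metric N (\<phi> x) (D2 x w u) (D x v) + metric N (\<phi> x) (D x u) (D2 x w v))) (at x)"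
    by (rule has_derivative_transform_within_open[OF _ M.open_points x]) (simp add: isometry)
  from has_derivative_unique[OF M.has_dmetric[OF x] this] show ?thesis by metis
qed

text \<open>
  The connection is natural up to the second derivative of the map, which enters because constant
  vector fields are not mapped to constant ones. In the Koszul formula the terms with second
  derivatives cancel in pairs, by their symmetry, and a single one is left.
\<close>

lemma christoffel:
  assumes x: "x \<in> points M"
  shows "D x (christoffel M x u v) = D2 x u v + christoffel N (\<phi> x) (D x u) (D x v)"
proof (rule D_eqI[OF x])
  fix z
  interpret g: inner_form "metric N (\<phi> x)"
    using N.inner_form_metric maps x by auto
  have "metric N (\<phi> x) (D x (christoffel M x u v)) (D x z) = M.koszul x u v z"
    using x by (simp add: isometry M.metric_christoffel)
  also have "\<dots> = N.koszul (\<phi> x) (D x u) (D x v) (D x z) + metric N (\<phi> x) (D2 x u v) (D x z)"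
  proof -
    have e: "(a + p + q + (b + p + r) - (c + q + r)) / 2 = (a + b - c) / 2 + p"
      for a b c p q r :: real by (simp add: field_simps)
    show ?thesis
      unfolding M.koszul_def N.koszul_def dmetric[OF x] D2_sym[OF x, where u = v and v = u]
        D2_sym[OF x, where u = z and v = u] D2_sym[OF x, where u = z and v = v] g.sym[of "D x v" "D2 x u z"] by (rule e)
  qed
  also have "\<dots> = metric N (\<phi> x) (D2 x u v + christoffel N (\<phi> x) (D x u) (D x v)) (D x z)"
    using x maps by (simp add: N.metric_christoffel)
  finally show "metric N (\<phi> x) (D x (christoffel M x u v)) (D x z)
    = metric N (\<phi> x) (D2 x u v + christoffel N (\<phi> x) (D x u) (D x v)) (D x z)" .
qed

text \<open>
  Differentiate the transformation rule of the connection once more. After antisymmetrisation in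
  the first two arguments, the third derivatives of the map cancel by their symmetry, and the
  terms with second derivatives cancel against each other.
\<close>

lemma curvature:
  assumes x: "x \<in> points M"
    and dM: "\<And>u v. (\<lambda>y. christoffel M y u v) differentiable (at x)"
    and dN: "\<And>u v. (\<lambda>y. christoffel N y u v) differentiable (at (\<phi> x))"
  shows "D x (riem_curvature M x u v w) = riem_curvature N (\<phi> x) (D x u) (D x v) (D x w)"
proof -
  let ?G = "christoffel M x" and ?H = "christoffel N (\<phi> x)"
  let ?dG = "\<lambda>h u v. frechet_derivative (\<lambda>y. christoffel M y u v) (at x) h"
  let ?dH = "\<lambda>h u v. frechet_derivative (\<lambda>y. christoffel N y u v) (at (\<phi> x)) h"
  have G: "((\<lambda>y. christoffel M y u v) has_derivative (\<lambda>h. ?dG h u v)) (at x)" for u v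
    using dM frechet_derivative_works by auto
  have H: "((\<lambda>y. christoffel N y u v) has_derivative (\<lambda>h. ?dH h u v)) (at (\<phi> x))" for u v
    using dN frechet_derivative_works by auto
  have bil: "bilinear ?H" using N.christoffel_bilinear maps x by auto
  have key: "D2 x h (?G a b) + D x (?dG h a b) = D3 x h a b + ?dH (D x h) (D x a) (D x b)
      + ?H (D2 x h a) (D x b) + ?H (D x a) (D2 x h b)" for h a b
  proof -
    have 1: "((\<lambda>y. D y (christoffel M y a b)) has_derivative
        (\<lambda>h. D2 x h (?G a b) + D x (?dG h a b))) (at x)"
      by (rule has_derivative_linear_family[where L = D, OF M.open_points x])
        (auto intro!: D_linear has_D2 G x)
    have "((\<lambda>y. christoffel N (\<phi> y) (D y a) (D y b)) has_derivative
        (\<lambda>h. ?dH (D x h) (D x a) (D x b) + ?H (D2 x h a) (D x b) + ?H (D x a) (D2 x h b))) (at x)"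
      by (rule has_derivative_bilinear_family[where L = "\<lambda>y. christoffel N (\<phi> y)", OF M.open_points x])
        (use x maps in \<open>auto intro!: N.christoffel_bilinear compose_has_derivative H has_D2\<close>)
    then have "((\<lambda>y. D2 y a b + christoffel N (\<phi> y) (D y a) (D y b)) has_derivative
        (\<lambda>h. D3 x h a b + (?dH (D x h) (D x a) (D x b) + ?H (D2 x h a) (D x b) + ?H (D x a) (D2 x h b)))) (at x)"
      by (intro has_derivative_add has_D3 x)
    then have "((\<lambda>y. D y (christoffel M y a b)) has_derivative
        (\<lambda>h. D3 x h a b + (?dH (D x h) (D x a) (D x b) + ?H (D2 x h a) (D x b) + ?H (D x a) (D2 x h b)))) (at x)"
      by (rule has_derivative_transform_within_open[OF _ M.open_points x]) (simp add: christoffel)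
    from fun_cong[OF has_derivative_unique[OF 1 this], of h] show ?thesis by (simp add: add.assoc)
  qed
  \<comment> \<open>The transformation rule itself eliminates the second derivative of \<open>\<phi>\<close>
      in the argument \<open>\<Gamma>(a, b)\<close>.\<close>
  have D2G: "D2 x h (?G a b) = D x (?G h (?G a b)) - ?H (D x h) (D2 x a b) - ?H (D x h) (?H (D x a) (D x b))"
    for h a b
    by (simp add: christoffel[OF x] bilinear_radd[OF bil])
  have DdG: "D x (?dG h a b) = D3 x h a b + ?dH (D x h) (D x a) (D x b) + ?H (D2 x h a) (D x b)
      + ?H (D x a) (D2 x h b) - D x (?G h (?G a b)) + ?H (D x h) (D2 x a b)
      + ?H (D x h) (?H (D x a) (D x b))" for h a b
    using key[where h = h and a = a and b = b] unfolding D2G by (simp add: algebra_simps)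
  have "D x (riem_curvature M x u v w)
      = D x (?dG u v w) - D x (?dG v u w) + D x (?G u (?G v w)) - D x (?G v (?G u w))"
    unfolding riem_curvature_def
    by (simp only: linear_add[OF D_linear[OF x]] linear_diff[OF D_linear[OF x]])
  also have "\<dots> = ?dH (D x u) (D x v) (D x w) - ?dH (D x v) (D x u) (D x w)
      + ?H (D x u) (?H (D x v) (D x w)) - ?H (D x v) (?H (D x u) (D x w))"
    unfolding DdG D3_sym[OF x, where w = v and u = u and v = w] D2_sym[OF x, where u = v and v = u]
    by simp
  finally show ?thesis unfolding riem_curvature_def .
qed

end

text \<open>
  The chain rule for the inverse map shows that the differential is surjective.
\<close>

lemma isometric_obtain:
  fixes M :: "'a::euclidean_space riem" and N :: "'b::euclidean_space riem"
  assumes iso: "isometric M N" and M: "C1_riemannian M" and N: "C1_riemannian N"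
  obtains \<phi> where "riem_isometry M N \<phi>"
proof -
  interpret M: C1_riemannian M by fact
  interpret N: C1_riemannian N by fact
  obtain \<phi> \<psi> where sm: "smooth_on (points M) \<phi>" "smooth_on (points N) \<psi>"
    and im: "\<phi> ` points M = points N" "\<psi> ` points N = points M"
    and inv: "\<forall>x\<in>points M. \<psi> (\<phi> x) = x" "\<forall>y\<in>points N. \<phi> (\<psi> y) = y"
    and met: "\<forall>x\<in>points M. \<forall>u v.
        metric N (\<phi> x) (frechet_derivative \<phi> (at x) u) (frechet_derivative \<phi> (at x) v)
          = metric M x u v"
    using iso unfolding isometric_def by blast
  have d\<phi>: "(\<phi> has_derivative frechet_derivative \<phi> (at x)) (at x)" if "x \<in> points M" for x
  proof -
    have "Ck_on (Suc 0) (points M) \<phi>" using sm(1) unfolding smooth_on_def by blast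
    then show ?thesis using that by (simp add: frechet_derivative_works)
  qed
  have d\<psi>: "(\<psi> has_derivative frechet_derivative \<psi> (at x)) (at x)" if "x \<in> points N" for x
  proof -
    have "Ck_on (Suc 0) (points N) \<psi>" using sm(2) unfolding smooth_on_def by blast
    then show ?thesis using that by (simp add: frechet_derivative_works)
  qed
  have "surj (frechet_derivative \<phi> (at x))" if x: "x \<in> points M" for x
  proof -
    have y: "\<phi> x \<in> points N" using im x by auto
    have "((\<lambda>y. \<phi> (\<psi> y)) has_derivative
        (\<lambda>h. frechet_derivative \<phi> (at x) (frechet_derivative \<psi> (at (\<phi> x)) h))) (at (\<phi> x))"
      using has_derivative_compose[OF d\<psi>[OF y], of \<phi>] d\<phi>[OF x] inv x by auto
    then have "((\<lambda>y. y) has_derivative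
        (\<lambda>h. frechet_derivative \<phi> (at x) (frechet_derivative \<psi> (at (\<phi> x)) h))) (at (\<phi> x))"
      by (rule has_derivative_transform_within_open[OF _ N.open_points y]) (use inv in auto)
    from has_derivative_unique[OF this has_derivative_ident] show ?thesis
      unfolding surj_def by metis
  qed
  then have "riem_isometry M N \<phi>"
    using sm im met by unfold_locales auto
  then show ?thesis by (rule that)
qed

lemma (in riem_isometry) gradient:
  assumes x: "x \<in> points M"
    and eq: "\<And>y. y \<in> points M \<Longrightarrow> t (\<phi> y) = s y"
    and ds: "(s has_derivative ds) (at x)" and dt: "(t has_derivative dt) (at (\<phi> x))"
    and S: "\<And>z. metric M x S z = ds z" and T: "\<And>z. metric N (\<phi> x) T z = dt z"
  shows "D x S = T"
proof (rule D_eqI[OF x])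
  fix z
  have "((\<lambda>y. t (\<phi> y)) has_derivative ds) (at x)"
    by (rule has_derivative_transform_within_open[OF ds M.open_points x]) (simp add: eq)
  from fun_cong[OF has_derivative_unique[OF this compose_has_derivative[OF x dt]]]
  have "ds z = dt (D x z)" .
  then show "metric N (\<phi> x) (D x S) (D x z) = metric N (\<phi> x) T (D x z)"
    by (simp add: isometry[OF x] S T)
qed

section \<open>Connection and curvature of the family\<close>

abbreviation E3 :: "real ^ 4" where "E3 \<equiv> axis 3 1"
abbreviation E4 :: "real ^ 4" where "E4 \<equiv> axis 4 1"

lemma axis_nth4 [simp]:
  fixes a :: real
  shows "(axis i a :: real ^ 4) $ j = (if i = j then a else 0)"
  by (simp add: axis_def)

text \<open>
  The coordinate form \<open>dx\<^sub>3 \<and> dx\<^sub>4\<close> of the fibre plane.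
\<close>

abbreviation area34 :: "real ^ 4 \<Rightarrow> real ^ 4 \<Rightarrow> real" where
  "area34 u v \<equiv> u $ 3 * v $ 4 - u $ 4 * v $ 3"

text \<open>
  The function \<open>h\<close>, the length of the fourth coordinate vector field. The length of
  the third one is \<open>x $ 1\<close>.
\<close>

definition warp :: "real \<Rightarrow> real ^ 4 \<Rightarrow> real" where
  "warp \<beta> x = x $ 1 + \<beta> * x $ 2"

lemma metric_M_beta: "metric (M_beta \<beta>) x u v = u $ 1 * v $ 1 + u $ 2 * v $ 2
    + (x $ 1)\<^sup>2 * (u $ 3 * v $ 3) + (warp \<beta> x)\<^sup>2 * (u $ 4 * v $ 4)"
  by (simp add: M_beta_def warp_def)

lemma points_M_beta [simp]: "x \<in> points (M_beta \<beta>) \<longleftrightarrow> x $ 1 > 0 \<and> x $ 2 > 0"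
  by (simp add: M_beta_def)

lemma factors_pos:
  assumes "\<beta> > 0" "x \<in> points (M_beta \<beta>)"
  shows "x $ 1 > 0" "warp \<beta> x > 0"
  using assms by (simp_all add: warp_def add_pos_pos)

lemma has_derivative_nth [derivative_intros]:
  "(f has_derivative f') F \<Longrightarrow> ((\<lambda>x. f x $ i) has_derivative (\<lambda>h. f' h $ i)) F"
  by (rule bounded_linear.has_derivative[OF bounded_linear_vec_nth])

lemma has_derivative_warp [derivative_intros]:
  "(f has_derivative f') F \<Longrightarrow> ((\<lambda>x. warp \<beta> (f x)) has_derivative (\<lambda>h. warp \<beta> (f' h))) F"
  unfolding warp_def by (auto intro!: derivative_eq_intros)

lemma open_points_M_beta: "open (points (M_beta \<beta>))"
proof -
  have "points (M_beta \<beta>) = {x. 0 < x $ 1} \<inter> {x. 0 < x $ 2}" by auto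
  then show ?thesis by (simp add: open_Collect_less continuous_on_component open_Int)
qed

lemma riemannian_M_beta:
  assumes "\<beta> > 0"
  shows "riemannian_manifold (M_beta \<beta>)"
  unfolding riemannian_manifold_def
proof (intro conjI ballI allI impI)
  show "smooth_on (points (M_beta \<beta>)) (\<lambda>x. metric (M_beta \<beta>) x u v)" for u v
    unfolding smooth_on_def
  proof
    fix k
    have "Ck_on k (points (M_beta \<beta>)) (\<lambda>x. (u $ 1 * v $ 1 + u $ 2 * v $ 2)
        + (x $ 1 * x $ 1) * (u $ 3 * v $ 3) + (warp \<beta> x * warp \<beta> x) * (u $ 4 * v $ 4))"
      by (intro Ck_on_add Ck_on_mult Ck_on_const open_points_M_beta Ck_on_bounded_linear)
        (auto simp: warp_def bounded_linear_vec_nth intro!: bounded_linear_add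
            bounded_linear_const_mult)
    then show "Ck_on k (points (M_beta \<beta>)) (\<lambda>x. metric (M_beta \<beta>) x u v)"
      by (simp add: metric_M_beta power2_eq_square)
  qed
next
  fix x assume x: "x \<in> points (M_beta \<beta>)"
  show "bilinear (metric (M_beta \<beta>) x)"
    unfolding bilinear_def by (intro allI conjI linearI; simp add: metric_M_beta algebra_simps)
  show "metric (M_beta \<beta>) x u v = metric (M_beta \<beta>) x v u" for u v
    by (simp add: metric_M_beta mult.commute)
  show "metric (M_beta \<beta>) x u u > 0" if u: "u \<noteq> 0" for u
  proof -
    have eq: "metric (M_beta \<beta>) x u u = (u $ 1)\<^sup>2 + (u $ 2)\<^sup>2 + (x $ 1 * u $ 3)\<^sup>2 + (warp \<beta> x * u $ 4)\<^sup>2"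
      by (simp add: metric_M_beta power2_eq_square)
    have "u $ 1 \<noteq> 0 \<or> u $ 2 \<noteq> 0 \<or> x $ 1 * u $ 3 \<noteq> 0 \<or> warp \<beta> x * u $ 4 \<noteq> 0"
      using u factors_pos[OF assms x] by (auto simp: vec_eq_iff forall_4)
    then show ?thesis
      unfolding eq using add_nonneg_nonneg zero_less_power2
      by (smt (verit) zero_le_power2)
  qed
qed (rule open_points_M_beta)

lemma C1_M_beta: "\<beta> > 0 \<Longrightarrow> C1_riemannian (M_beta \<beta>)"
  by (rule riemannian_manifold_imp_C1[OF riemannian_M_beta])

lemma christoffel_M_beta:
  assumes "\<beta> > 0" and x: "x \<in> points (M_beta \<beta>)"
  shows "christoffel (M_beta \<beta>) x u v =
      (- (x $ 1 * u $ 3 * v $ 3) - warp \<beta> x * u $ 4 * v $ 4) *\<^sub>R axis 1 1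
    + (- (\<beta> * warp \<beta> x * u $ 4 * v $ 4)) *\<^sub>R axis 2 1
    + ((u $ 1 * v $ 3 + u $ 3 * v $ 1) / x $ 1) *\<^sub>R E3
    + ((warp \<beta> u * v $ 4 + u $ 4 * warp \<beta> v) / warp \<beta> x) *\<^sub>R E4"
    (is "_ = ?G")
proof -
  interpret M: C1_riemannian "M_beta \<beta>" using assms by (intro C1_M_beta)
  have "((\<lambda>x. metric (M_beta \<beta>) x u v) has_derivative
      (\<lambda>h. 2 * x $ 1 * h $ 1 * (u $ 3 * v $ 3) + 2 * warp \<beta> x * warp \<beta> h * (u $ 4 * v $ 4))) (at x)" for u v
    unfolding metric_M_beta by (auto intro!: derivative_eq_intros simp: algebra_simps)
  from fun_cong[OF frechet_derivative_at[OF this], symmetric]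
  have d: "M.dmetric x h u v = 2 * x $ 1 * h $ 1 * (u $ 3 * v $ 3) + 2 * warp \<beta> x * warp \<beta> h * (u $ 4 * v $ 4)"
    for h u v .
  show ?thesis
  proof (rule M.christoffel_eqI[OF x])
    fix z
    have pos: "x $ 1 \<noteq> 0" "warp \<beta> x \<noteq> 0" using factors_pos[OF assms(1) x] by auto
    show "metric (M_beta \<beta>) x ?G z = M.koszul x u v z"
      unfolding M.koszul_def d unfolding metric_M_beta using pos
      by (simp add: warp_def[of _ u] warp_def[of _ v] warp_def[of _ z])
        (simp add: power2_eq_square field_simps)
  qed
qed

lemma christoffel_M_beta_has_derivative:
  assumes "\<beta> > 0" and x: "x \<in> points (M_beta \<beta>)"
  shows "((\<lambda>y. christoffel (M_beta \<beta>) y u v) has_derivative (\<lambda>h.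
      (- (h $ 1 * u $ 3 * v $ 3) - warp \<beta> h * u $ 4 * v $ 4) *\<^sub>R axis 1 1
    + (- (\<beta> * warp \<beta> h * u $ 4 * v $ 4)) *\<^sub>R axis 2 1
    + (- ((u $ 1 * v $ 3 + u $ 3 * v $ 1) * h $ 1 / (x $ 1)\<^sup>2)) *\<^sub>R E3
    + (- ((warp \<beta> u * v $ 4 + u $ 4 * warp \<beta> v) * warp \<beta> h / (warp \<beta> x)\<^sup>2)) *\<^sub>R E4)) (at x)"
proof (rule has_derivative_transform_within_open[OF _ open_points_M_beta x])
  have pos: "x $ 1 \<noteq> 0" "warp \<beta> x \<noteq> 0" using factors_pos[OF assms(1) x] by auto
  show "((\<lambda>x. (- (x $ 1 * u $ 3 * v $ 3) - warp \<beta> x * u $ 4 * v $ 4) *\<^sub>R axis 1 1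
    + (- (\<beta> * warp \<beta> x * u $ 4 * v $ 4)) *\<^sub>R axis 2 1
    + ((u $ 1 * v $ 3 + u $ 3 * v $ 1) / x $ 1) *\<^sub>R E3
    + ((warp \<beta> u * v $ 4 + u $ 4 * warp \<beta> v) / warp \<beta> x) *\<^sub>R E4) has_derivative (\<lambda>h.
      (- (h $ 1 * u $ 3 * v $ 3) - warp \<beta> h * u $ 4 * v $ 4) *\<^sub>R axis 1 1
    + (- (\<beta> * warp \<beta> h * u $ 4 * v $ 4)) *\<^sub>R axis 2 1
    + (- ((u $ 1 * v $ 3 + u $ 3 * v $ 1) * h $ 1 / (x $ 1)\<^sup>2)) *\<^sub>R E3
    + (- ((warp \<beta> u * v $ 4 + u $ 4 * warp \<beta> v) * warp \<beta> h / (warp \<beta> x)\<^sup>2)) *\<^sub>R E4)) (at x)"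
    using pos by (auto intro!: derivative_eq_intros simp: power2_eq_square divide_inverse mult_ac)
qed (simp add: christoffel_M_beta[OF assms(1)])

lemma christoffel_M_beta_differentiable:
  "\<beta> > 0 \<Longrightarrow> x \<in> points (M_beta \<beta>) \<Longrightarrow> (\<lambda>y. christoffel (M_beta \<beta>) y u v) differentiable (at x)"
  using christoffel_M_beta_has_derivative unfolding differentiable_def by blast

text \<open>
  No term with a base component survives: these would be second derivatives of \<open>f\<close>
  and \<open>h\<close>.
\<close>

lemma curvature_M_beta:
  assumes "\<beta> > 0" and x: "x \<in> points (M_beta \<beta>)"
  shows "riem_curvature (M_beta \<beta>) x u v w = area34 u v *\<^sub>R
    ((- (warp \<beta> x / x $ 1) * w $ 4) *\<^sub>R E3 + (x $ 1 / warp \<beta> x * w $ 3) *\<^sub>R E4)"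
proof -
  have pos: "x $ 1 \<noteq> 0" "warp \<beta> x \<noteq> 0" using factors_pos[OF assms(1) x] by auto
  note d = fun_cong[OF frechet_derivative_at[OF christoffel_M_beta_has_derivative[OF assms]], symmetric]
  show ?thesis
    unfolding riem_curvature_def d christoffel_M_beta[OF assms] using pos
    by (simp add: vec_eq_iff forall_4 warp_def[of _ u] warp_def[of _ v] warp_def[of _ w] warp_def[of _ "_ + _"])
      (simp add: field_simps power2_eq_square)
qed

lemma curvature_tensor_M_beta:
  assumes "\<beta> > 0" and x: "x \<in> points (M_beta \<beta>)"
  shows "curvature_tensor (M_beta \<beta>) x [a, b, c, d] = x $ 1 * warp \<beta> x * area34 a b * area34 c d"
proof -
  have pos: "x $ 1 \<noteq> 0" "warp \<beta> x \<noteq> 0" using factors_pos[OF assms(1) x] by auto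
  then show ?thesis
    by (simp add: curvature_tensor_def curvature_M_beta[OF assms] metric_M_beta power2_eq_square algebra_simps)
qed

section \<open>Jacobi operators\<close>

lemma k_model_form [simp]: "form (k_model k M P) = metric M P"
  by (simp add: k_model_def)

lemma k_model_tensors: "j \<le> k \<Longrightarrow> tensors (k_model k M P) ! j = nabla_curvature j M P"
  by (simp add: k_model_def del: upt_Suc)

lemma length_k_model_tensors [simp]: "length (tensors (k_model k M P)) = Suc k"
  by (simp add: k_model_def)

lemma nabla_curvature_0 [simp]: "nabla_curvature 0 M = curvature_tensor M"
  by (simp add: nabla_curvature_def)

lemma jacobi_op_k_model:
  assumes "inner_form (metric M P)"
  shows "jacobi_op (k_model k M P) v w = riem_curvature M P w v v"
  unfolding jacobi_op_def curvature_op_def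
  by (simp add: k_model_tensors curvature_tensor_def inner_form.sharp_eqI[OF assms])

text \<open>
  The definition selects some orthonormal basis of \<open>W\<close>; by the Gram--Schmidt process
  there is one to select.
\<close>

lemma higher_jacobi_op_k_model:
  assumes P: "inner_form (metric M P)" and W: "subspace W"
  obtains B where "orthonormal_basis_of (metric M P) B W"
    "\<And>w. higher_jacobi_op (k_model k M P) W w = (\<Sum>v\<in>B. riem_curvature M P w v v)"
proof
  show "orthonormal_basis_of (metric M P) (SOME B. orthonormal_basis_of (metric M P) B W) W"
    by (rule someI_ex[OF inner_form.orthonormal_basis_exists[OF P W]])
  show "higher_jacobi_op (k_model k M P) W w
      = (\<Sum>v\<in>(SOME B. orthonormal_basis_of (metric M P) B W). riem_curvature M P w v v)" for w
    by (simp add: higher_jacobi_op_def jacobi_op_k_model[OF P])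
qed

text \<open>
  The sum over a set of vectors \<open>v\<close> of the Jacobi operators depends only on the Gram
  data \<open>p = \<Sum> v\<^sub>3 v\<^sub>3\<close>, \<open>q = \<Sum> v\<^sub>3
  v\<^sub>4\<close>, \<open>r = \<Sum> v\<^sub>4 v\<^sub>4\<close> of the fibre components.
\<close>

definition jacobi34 :: "real \<Rightarrow> real ^ 4 \<Rightarrow> real \<Rightarrow> real \<Rightarrow> real \<Rightarrow> real ^ 4 \<Rightarrow> real ^ 4" where
  "jacobi34 \<beta> x p q r w = (- (warp \<beta> x / x $ 1) * (w $ 3 * r - w $ 4 * q)) *\<^sub>R E3
     + (x $ 1 / warp \<beta> x * (w $ 3 * q - w $ 4 * p)) *\<^sub>R E4"

lemma sum_curvature_M_beta:
  assumes "\<beta> > 0" "x \<in> points (M_beta \<beta>)"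
  shows "(\<Sum>v\<in>B. riem_curvature (M_beta \<beta>) x w v v)
    = jacobi34 \<beta> x (\<Sum>v\<in>B. v $ 3 * v $ 3) (\<Sum>v\<in>B. v $ 3 * v $ 4) (\<Sum>v\<in>B. v $ 4 * v $ 4) w"
  unfolding curvature_M_beta[OF assms] jacobi34_def
  by (simp add: vec_eq_iff forall_4 sum_distrib_left sum_subtractf[symmetric] algebra_simps)

text \<open>
  These are the components of the inverse metric; Parseval's identity for the coordinate vectors
  of the fibres gives them.
\<close>

lemma orthonormal_basis_sums_M_beta:
  assumes "\<beta> > 0" and x: "x \<in> points (M_beta \<beta>)"
    and B: "orthonormal_basis_of (metric (M_beta \<beta>) x) B UNIV"
  shows "(\<Sum>v\<in>B. v $ 3 * v $ 3) = 1 / (x $ 1)\<^sup>2" "(\<Sum>v\<in>B. v $ 3 * v $ 4) = 0"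
    "(\<Sum>v\<in>B. v $ 4 * v $ 4) = 1 / (warp \<beta> x)\<^sup>2"
proof -
  have pos: "x $ 1 \<noteq> 0" "warp \<beta> x \<noteq> 0" using factors_pos[OF assms(1) x] by auto
  interpret g: inner_form "metric (M_beta \<beta>) x"
    by (rule C1_riemannian.inner_form_metric[OF C1_M_beta x]) fact
  note p = g.orthonormal_basis_parseval[OF B]
  have "(x $ 1)\<^sup>2 * (x $ 1)\<^sup>2 * (\<Sum>v\<in>B. v $ 3 * v $ 3) = (x $ 1)\<^sup>2"
    using p[of E3 E3] by (simp add: metric_M_beta sum_distrib_left mult_ac)
  then show "(\<Sum>v\<in>B. v $ 3 * v $ 3) = 1 / (x $ 1)\<^sup>2"
    using pos by (simp add: field_simps power2_eq_square)
  have "(x $ 1)\<^sup>2 * (warp \<beta> x)\<^sup>2 * (\<Sum>v\<in>B. v $ 3 * v $ 4) = 0"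
    using p[of E3 E4] by (simp add: metric_M_beta sum_distrib_left mult_ac)
  then show "(\<Sum>v\<in>B. v $ 3 * v $ 4) = 0"
    using pos by simp
  have "(warp \<beta> x)\<^sup>2 * (warp \<beta> x)\<^sup>2 * (\<Sum>v\<in>B. v $ 4 * v $ 4) = (warp \<beta> x)\<^sup>2"
    using p[of E4 E4] by (simp add: metric_M_beta sum_distrib_left mult_ac)
  then show "(\<Sum>v\<in>B. v $ 4 * v $ 4) = 1 / (warp \<beta> x)\<^sup>2"
    using pos by (simp add: field_simps power2_eq_square)
qed

text \<open>
  The Gram data of a subspace and of its orthogonal complement add up to the inverse metric, for
  which the operator is a multiple of the projection to the fibre plane. Hence the operator of the
  complement is this multiple minus the operator of the subspace, and the two commute.
\<close>

lemma jacobi34_commute: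
  assumes "x $ 1 \<noteq> 0" "warp \<beta> x \<noteq> 0"
  shows "jacobi34 \<beta> x p q r (jacobi34 \<beta> x (1 / (x $ 1)\<^sup>2 - p) (- q) (1 / (warp \<beta> x)\<^sup>2 - r) w)
    = jacobi34 \<beta> x (1 / (x $ 1)\<^sup>2 - p) (- q) (1 / (warp \<beta> x)\<^sup>2 - r) (jacobi34 \<beta> x p q r w)"
  using assms unfolding jacobi34_def by (simp add: vec_eq_iff forall_4 field_simps power2_eq_square)

lemma puffini_videv_M_beta:
  assumes \<beta>: "\<beta> > 0"
  shows "puffini_videv (M_beta \<beta>)"
  unfolding puffini_videv_def puffini_videv_model_def
proof (intro ballI allI impI)
  fix x and W :: "(real ^ 4) set" assume x: "x \<in> points (M_beta \<beta>)" and W: "subspace W"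
  let ?g = "metric (M_beta \<beta>) x" and ?J = "higher_jacobi_op (k_model 0 (M_beta \<beta>) x)"
  have pos: "x $ 1 \<noteq> 0" "warp \<beta> x \<noteq> 0" using factors_pos[OF assms(1) x] by auto
  interpret g: inner_form ?g
    by (rule C1_riemannian.inner_form_metric[OF C1_M_beta x]) fact
  have W': "subspace (orth_compl ?g W)"
    by (auto simp: subspace_def orth_compl_def)
  obtain B where B: "orthonormal_basis_of ?g B W"
    and JB: "\<And>w. ?J W w = (\<Sum>v\<in>B. riem_curvature (M_beta \<beta>) x w v v)"
    using higher_jacobi_op_k_model[OF g.inner_form_axioms W] by blast
  obtain C where C: "orthonormal_basis_of ?g C (orth_compl ?g W)"
    and JC: "\<And>w. ?J (orth_compl ?g W) w = (\<Sum>v\<in>C. riem_curvature (M_beta \<beta>) x w v v)"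
    using higher_jacobi_op_k_model[OF g.inner_form_axioms W'] by blast
  have fin: "finite B" "finite C" using B C by (auto simp: orthonormal_basis_of_def)
  note BC = g.orthonormal_basis_Un_orth_compl[OF B C]
  \<comment> \<open>The Gram data of the complement, in the form that the commutation lemma expects.\<close>
  have split: "(\<Sum>v\<in>C. f v) = (\<Sum>v\<in>B \<union> C. f v) - (\<Sum>v\<in>B. f v)" for f :: "real ^ 4 \<Rightarrow> real"
    using fin BC(2) by (simp add: sum.union_disjoint)
  show "?J W \<circ> ?J (orth_compl (form (k_model 0 (M_beta \<beta>) x)) W)
      = ?J (orth_compl (form (k_model 0 (M_beta \<beta>) x)) W) \<circ> ?J W"
    unfolding k_model_form fun_eq_iff o_apply JB JC sum_curvature_M_beta[OF \<beta> x] split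
      orthonormal_basis_sums_M_beta[OF \<beta> x BC(1)] diff_0
    using jacobi34_commute[OF pos] by blast
qed

lemma not_einstein_M_beta:
  assumes \<beta>: "\<beta> > 0"
  shows "\<not> einstein (M_beta \<beta>)"
proof
  assume E: "einstein (M_beta \<beta>)"
  define x :: "real ^ 4" where "x = axis 1 1 + axis 2 1"
  have x: "x \<in> points (M_beta \<beta>)" by (simp add: x_def)
  have pos: "x $ 1 > 0" "warp \<beta> x > 0" using factors_pos[OF assms(1) x] by auto
  obtain c where c: "ricci_op (k_model 0 (M_beta \<beta>) x) = (\<lambda>v. c *\<^sub>R v)"
    using E x unfolding einstein_def by blast
  obtain B where B: "orthonormal_basis_of (metric (M_beta \<beta>) x) B UNIV"
    and J: "\<And>w. ricci_op (k_model 0 (M_beta \<beta>) x) w = (\<Sum>v\<in>B. riem_curvature (M_beta \<beta>) x w v v)"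
    using higher_jacobi_op_k_model[OF C1_riemannian.inner_form_metric[OF C1_M_beta[OF \<beta>] x] subspace_UNIV]
    unfolding ricci_op_def by blast
  have "jacobi34 \<beta> x (1 / (x $ 1)\<^sup>2) 0 (1 / (warp \<beta> x)\<^sup>2) w = c *\<^sub>R w" for w
    using J[of w] unfolding c sum_curvature_M_beta[OF \<beta> x] orthonormal_basis_sums_M_beta[OF \<beta> x B]
    by simp
  \<comment> \<open>The Ricci operator kills the base vector but not the fibre vector.\<close>
  from this[of "axis 1 1"] this[of E3] show False
    using pos by (simp add: jacobi34_def vec_eq_iff forall_4)
qed

section \<open>Indecomposability of the models\<close>

text \<open>
  With a base vector \<open>\<xi>\<close> in the second slot, the curvature vanishes identically,
  and so do all terms of the covariant derivative except the one in which \<open>\<xi>\<close> is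
  replaced by its own covariant derivative.
\<close>

lemma nabla_curvature_base_vector:
  assumes \<beta>: "\<beta> > 0" and x: "x \<in> points (M_beta \<beta>)" and \<xi>: "\<xi> $ 3 = 0" "\<xi> $ 4 = 0"
  shows "nabla_curvature (Suc 0) (M_beta \<beta>) x [u, a, \<xi>, c, d]
    = - (x $ 1 * warp \<beta> x * area34 a (christoffel (M_beta \<beta>) x u \<xi>) * area34 c d)"
proof -
  have "((\<lambda>y. curvature_tensor (M_beta \<beta>) y [a, \<xi>, c, d]) has_derivative (\<lambda>h. 0)) (at x)"
    by (rule has_derivative_transform_within_open[OF has_derivative_const open_points_M_beta x, of 0])
      (simp add: curvature_tensor_M_beta[OF \<beta>] \<xi> del: points_M_beta)
  note fun_cong[OF frechet_derivative_at[OF this], symmetric]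
  then show ?thesis
    by (simp add: nabla_curvature_def curvature_tensor_M_beta[OF \<beta> x] christoffel_M_beta[OF \<beta> x] \<xi>
        lessThan_Suc numeral_eq_Suc)
qed

text \<open>
  The curvature and its first covariant derivative already exclude a splitting. If a summand
  \<open>W\<close> has no curvature of its own, then \<open>dx\<^sub>3 \<and> dx\<^sub>4\<close>
  annihilates it, so that \<open>W\<close> consists of base vectors and the other summand contains
  the fibre plane. Then \<open>\<nabla>R\<close>, evaluated on \<open>\<xi> \<in> W\<close> and
  fibre vectors, is a mixed component, and its vanishing gives \<open>\<xi>(f) = \<xi>(h) =
  0\<close>.
\<close>

lemma indecomposable_M_beta:
  assumes \<beta>: "\<beta> > 0" and x: "x \<in> points (M_beta \<beta>)" and k: "k \<ge> 1"
  shows "indecomposable (k_model k (M_beta \<beta>) x)"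
  unfolding indecomposable_def
proof
  let ?g = "metric (M_beta \<beta>) x" and ?R = "curvature_tensor (M_beta \<beta>) x"
    and ?nR = "nabla_curvature (Suc 0) (M_beta \<beta>) x"
  assume "decomposable (k_model k (M_beta \<beta>) x)"
  then obtain V1 V2 where V: "subspace V1" "subspace V2" "V1 \<noteq> {0}" "V2 \<noteq> {0}"
    and sum: "\<forall>v. \<exists>a\<in>V1. \<exists>b\<in>V2. v = a + b"
    and orth: "\<forall>a\<in>V1. \<forall>b\<in>V2. ?g a b = 0"
    and T: "\<forall>j<Suc k. \<forall>vs. length vs = 4 + j \<longrightarrow> set vs \<subseteq> V1 \<union> V2 \<longrightarrow> \<not> set vs \<subseteq> V1 \<longrightarrow>
        \<not> set vs \<subseteq> V2 \<longrightarrow> (tensors (k_model k (M_beta \<beta>) x) ! j) vs = 0"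
    unfolding decomposable_def by auto
  interpret g: inner_form ?g
    by (rule C1_riemannian.inner_form_metric[OF C1_M_beta x]) fact
  have pos: "x $ 1 > 0" "warp \<beta> x > 0" using factors_pos[OF assms(1) x] by auto
  have disj: "v = 0" if "v \<in> V1" "v \<in> V2" for v
    using orth that g.pos[of v] by force
  have R: "area34 a b * area34 c d = 0"
    if "a \<in> V1 \<union> V2" "b \<in> V1 \<union> V2" "c \<in> V1 \<union> V2" "d \<in> V1 \<union> V2"
      "\<not> {a, b, c, d} \<subseteq> V1" "\<not> {a, b, c, d} \<subseteq> V2" for a b c d
  proof -
    have "?R [a, b, c, d] = 0"
      using T[rule_format, of 0 "[a, b, c, d]"] that by (simp add: k_model_tensors)
    then show ?thesis using pos by (simp add: curvature_tensor_M_beta[OF \<beta> x])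
  qed
  have nR: "?nR [u, a, b, c, d] = 0"
    if "set [u, a, b, c, d] \<subseteq> V1 \<union> V2" "\<not> set [u, a, b, c, d] \<subseteq> V1" "\<not> set [u, a, b, c, d] \<subseteq> V2" for u a b c d
    using T[rule_format, of "Suc 0" "[u, a, b, c, d]"] that k by (simp add: k_model_tensors)
  have mixed: "area34 a b = 0" if "a \<in> V1" "b \<in> V2" for a b
  proof (cases "a = 0 \<or> b = 0")
    case False
    then show ?thesis using R[of a b a b] that disj by auto
  qed auto
  \<comment> \<open>Stated for both orders of the summands: it is not known in advance which of them carries
      the curvature.\<close>
  have flat_False: False if W: "W = V1 \<and> W' = V2 \<or> W = V2 \<and> W' = V1"
    and flat: "\<And>a b. a \<in> W \<Longrightarrow> b \<in> W \<Longrightarrow> area34 a b = 0" for W W'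
  proof -
    have W_sum: "\<exists>a\<in>W. \<exists>b\<in>W'. v = a + b" for v
      using sum W by (metis add.commute)
    have W_orth: "?g a b = 0" if "a \<in> W" "b \<in> W'" for a b
      using orth W that g.sym by metis
    have \<xi>34: "\<xi> $ 3 = 0 \<and> \<xi> $ 4 = 0" if \<xi>: "\<xi> \<in> W" for \<xi>
    proof -
      have "area34 \<xi> v = 0" for v
      proof -
        obtain a b where ab: "a \<in> W" "b \<in> W'" "v = a + b" using W_sum by blast
        have "area34 \<xi> a = 0" "area34 \<xi> b = 0 \<or> area34 b \<xi> = 0"
          using flat[OF \<xi> ab(1)] mixed[of \<xi> b] mixed[of b \<xi>] W \<xi> ab(1,2) by metis+
        then show ?thesis by (auto simp: ab(3) algebra_simps)
      qed
      from this[of E3] this[of E4] show ?thesis by simp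
    qed
    have inW': "v \<in> W'" if v: "v $ 1 = 0" "v $ 2 = 0" for v
    proof -
      obtain a b where ab: "a \<in> W" "b \<in> W'" "v = a + b" using W_sum by blast
      have "?g a v = 0" using \<xi>34[OF ab(1)] v by (simp add: metric_M_beta)
      then have "?g a a = 0" using W_orth[OF ab(1,2)] ab(3) by simp
      then show ?thesis using g.pos[of a] ab by force
    qed
    have E: "E3 \<in> W'" "E4 \<in> W'" by (auto intro: inW')
    have "\<xi> = 0" if \<xi>: "\<xi> \<in> W" for \<xi>
    proof (rule ccontr)
      assume "\<xi> \<noteq> 0"
      then have mix: "\<xi> \<notin> W'" "E3 \<notin> W" "E4 \<notin> W"
        using \<xi> E W_orth[of \<xi> \<xi>] g.pos[of \<xi>] \<xi>34[of E3] \<xi>34[of E4] by auto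
      have "?nR [E4, E3, \<xi>, E3, E4] = 0" "?nR [E3, E4, \<xi>, E3, E4] = 0"
        by (rule nR; use W E \<xi> mix in auto)+
      then have "warp \<beta> \<xi> = 0" "\<xi> $ 1 = 0"
        using pos \<xi>34[OF \<xi>] by (auto simp: nabla_curvature_base_vector[OF \<beta> x] christoffel_M_beta[OF \<beta> x])
      then have "\<xi> = 0" using \<xi>34[OF \<xi>] \<beta> by (simp add: vec_eq_iff forall_4 warp_def)
      with \<open>\<xi> \<noteq> 0\<close> show False ..
    qed
    moreover have "0 \<in> W" using V W subspace_0 by blast
    ultimately show False using V W by blast
  qed
  show False
  proof (cases "\<forall>a\<in>V1. \<forall>b\<in>V1. area34 a b = 0")
    case True
    then show False using flat_False[of V1 V2] by blast
  next
    case False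
    then obtain a b where ab: "a \<in> V1" "b \<in> V1" "area34 a b \<noteq> 0" by blast
    \<comment> \<open>The component \<open>R(a, b, c, d)\<close> is mixed, and its first factor is not zero.\<close>
    have "area34 c d = 0" if "c \<in> V2" "d \<in> V2" for c d
    proof (cases "c = 0")
      case False
      then have "a \<noteq> 0" "c \<notin> V1" "a \<notin> V2 \<or> a = 0" using ab that disj by auto
      then show ?thesis using R[of a b c d] ab that by auto
    qed simp
    then show False using flat_False[of V2 V1] by blast
  qed
qed

section \<open>Scalar curvature\<close>

lemma inv_form_M_beta:
  assumes \<beta>: "\<beta> > 0" and x: "x \<in> points (M_beta \<beta>)"
  shows "inv_form (metric (M_beta \<beta>) x) (axis i 1) (axis j 1)
    = (if i = j then (if i = 3 then 1 / (x $ 1)\<^sup>2 else if i = 4 then 1 / (warp \<beta> x)\<^sup>2 else 1) else 0)"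
proof -
  interpret g: inner_form "metric (M_beta \<beta>) x"
    by (rule C1_riemannian.inner_form_metric[OF C1_M_beta x]) fact
  have pos: "x $ 1 \<noteq> 0" "warp \<beta> x \<noteq> 0" using factors_pos[OF assms(1) x] by auto
  have "sharp (metric (M_beta \<beta>) x) (\<lambda>z. z \<bullet> axis i 1)
      = (if i = 3 then 1 / (x $ 1)\<^sup>2 else if i = 4 then 1 / (warp \<beta> x)\<^sup>2 else 1) *\<^sub>R axis i 1"
    using pos exhaust_4[of i] by (intro g.sharp_eqI) (auto simp: metric_M_beta inner_axis)
  then show ?thesis by (simp add: inv_form_def inner_axis)
qed

lemma scalar_curvature_M_beta:
  assumes \<beta>: "\<beta> > 0" and x: "x \<in> points (M_beta \<beta>)"
  shows "scalar_curvature (M_beta \<beta>) x = - 2 / (x $ 1 * warp \<beta> x)"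
proof -
  have pos: "x $ 1 \<noteq> 0" "warp \<beta> x \<noteq> 0" using factors_pos[OF assms(1) x] by auto
  have Basis: "(\<Sum>i\<in>Basis. f i) = (\<Sum>i\<in>UNIV. f (axis i 1))" for f :: "real ^ 4 \<Rightarrow> real"
    by (simp add: Basis_vec_def UNION_singleton_eq_range sum.reindex inj_on_def axis_eq_axis)
  show ?thesis
    unfolding scalar_curvature_def Basis inv_form_M_beta[OF \<beta> x] curvature_tensor_M_beta[OF \<beta> x]
    using pos by (simp add: sum_4 power2_eq_square field_simps)
qed

lemma scalar_curvature_blowup_M_beta:
  assumes \<beta>: "\<beta> > 0"
  shows "scalar_curvature_blowup (M_beta \<beta>)"
proof -
  define \<gamma> :: "real \<Rightarrow> real ^ 4" where "\<gamma> t = t *\<^sub>R axis 1 1 + axis 2 1" for t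
  have pts: "\<gamma> t \<in> points (M_beta \<beta>)" if "t > 0" for t
    using that by (simp add: \<gamma>_def)
  have \<tau>: "scalar_curvature (M_beta \<beta>) (\<gamma> t) = - 2 / (t * (t + \<beta>))" if "t > 0" for t
    unfolding scalar_curvature_M_beta[OF \<beta> pts[OF that]] by (simp add: \<gamma>_def warp_def)
  have "geodesic_on (M_beta \<beta>) {0<..<1} \<gamma>"
    unfolding geodesic_on_def
  proof (intro exI[of _ "\<lambda>t. axis 1 1"] ballI conjI)
    fix t :: real assume "t \<in> {0<..<1}"
    then have t: "t > 0" by simp
    show "\<gamma> t \<in> points (M_beta \<beta>)" by (rule pts[OF t])
    show "(\<gamma> has_vector_derivative axis 1 1) (at t)"
      unfolding \<gamma>_def by (auto intro!: derivative_eq_intros)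
    show "((\<lambda>t. axis 1 1) has_vector_derivative
        - christoffel (M_beta \<beta>) (\<gamma> t) (axis 1 1) (axis 1 1)) (at t)"
      by (simp add: christoffel_M_beta[OF \<beta> pts[OF t]])
  qed
  moreover have "filterlim (\<lambda>t. \<bar>scalar_curvature (M_beta \<beta>) (\<gamma> t)\<bar>) at_top (at_right 0)"
  proof -
    have "filterlim (\<lambda>t. 2 / (t * (t + \<beta>))) at_top (at_right (0::real))"
    proof (rule filterlim_at_top_mono)
      \<comment> \<open>On \<open>0 < t < 1\<close> the factor \<open>t + \<beta>\<close> is at most
          \<open>1 + \<beta>\<close>.\<close>
      show "LIM t at_right (0::real). 2 / (1 + \<beta>) * inverse t :> at_top"
        using \<beta> by (intro filterlim_tendsto_pos_mult_at_top[OF tendsto_const]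
            filterlim_inverse_at_top_right) auto
      show "\<forall>\<^sub>F t in at_right 0. 2 / (1 + \<beta>) * inverse t \<le> 2 / (t * (t + \<beta>))"
        unfolding eventually_at_right_field
      proof (intro exI[of _ 1] conjI allI impI)
        fix t :: real assume t: "0 < t" "t < 1"
        have "2 / (1 + \<beta>) \<le> 2 / (t + \<beta>)" using t \<beta> by (intro divide_left_mono) auto
        then have "2 / (1 + \<beta>) * inverse t \<le> 2 / (t + \<beta>) * inverse t"
          using t by (intro mult_right_mono) auto
        then show "2 / (1 + \<beta>) * inverse t \<le> 2 / (t * (t + \<beta>))"
          by (simp add: divide_inverse mult_ac)
      qed simp
    qed
    then show ?thesis
      by (rule filterlim_mono_eventually[OF _ order_refl order_refl])
        (use \<beta> in \<open>auto simp: eventually_at_right_field \<tau> intro!: exI[of _ 1]\<close>)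
  qed
  ultimately show ?thesis
    unfolding scalar_curvature_blowup_def using zero_less_one by blast
qed

section \<open>Local irreducibility\<close>

text \<open>
  The metric of the first factor, pulled back to \<open>M\<close>, is parallel. This is the
  transformation rule of the connection, read in the first component, together with metric
  compatibility in the factor.
\<close>

lemma product_form_parallel:
  assumes M1: "C1_riemannian M1" and M2: "C1_riemannian M2"
    and \<phi>: "riem_isometry M (riem_product M1 M2) \<phi>" and x: "x \<in> points M"
  defines "B \<equiv> \<lambda>x v w. metric M1 (fst (\<phi> x)) (fst (frechet_derivative \<phi> (at x) v))
      (fst (frechet_derivative \<phi> (at x) w))"
  shows "((\<lambda>y. B y v w) has_derivative
      (\<lambda>u. B x (christoffel M x u v) w + B x v (christoffel M x u w))) (at x)"
proof -
  interpret M1: C1_riemannian M1 by fact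
  interpret M2: C1_riemannian M2 by fact
  interpret riem_isometry M "riem_product M1 M2" \<phi> by fact
  have pts: "fst (\<phi> y) \<in> points M1" if "y \<in> points M" for y
    using maps[OF that] by (auto simp: riem_product_def)
  interpret g: inner_form "metric M1 (fst (\<phi> x))"
    by (rule M1.inner_form_metric[OF pts[OF x]])
  have "((\<lambda>y. B y v w) has_derivative (\<lambda>u.
      M1.dmetric (fst (\<phi> x)) (fst (D x u)) (fst (D x v)) (fst (D x w))
    + metric M1 (fst (\<phi> x)) (fst (D2 x u v)) (fst (D x w))
    + metric M1 (fst (\<phi> x)) (fst (D x v)) (fst (D2 x u w)))) (at x)"
    unfolding B_def
  proof (rule has_derivative_bilinear_family[where L = "\<lambda>y. metric M1 (fst (\<phi> y))", OF M.open_points x])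
    show "bilinear (metric M1 (fst (\<phi> y)))" if "y \<in> points M" for y
      by (rule M1.metric_bilinear[OF pts[OF that]])
    show "((\<lambda>y. metric M1 (fst (\<phi> y)) a b) has_derivative
        (\<lambda>u. M1.dmetric (fst (\<phi> x)) (fst (D x u)) a b)) (at x)" for a b
      using has_derivative_compose[OF has_derivative_fst[OF has_D[OF x]] M1.has_dmetric[OF pts[OF x]]] .
  qed (intro has_derivative_fst has_D2 x)+
  moreover have "fst (D2 x u v) = fst (D x (christoffel M x u v))
      - christoffel M1 (fst (\<phi> x)) (fst (D x u)) (fst (D x v))" for u v
    using arg_cong[OF christoffel[OF x, of u v], of fst]
    by (simp add: christoffel_product[OF M1 M2 maps[OF x]])
  ultimately show ?thesis
    unfolding M1.metric_compatible[OF pts[OF x]] by (simp add: B_def)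
qed

text \<open>
  The equation \<open>\<nabla>B = 0\<close> prescribes all first derivatives of the components
  \<open>b\<^sub>i\<^sub>j\<close>. It is used through its integrability conditions. The symmetry
  of the derivatives of \<open>b\<^sub>3\<^sub>3\<close> in the directions \<open>3, 4\<close>,
  which expresses the curvature of the fibre plane, gives \<open>b\<^sub>3\<^sub>4 = 0\<close>.
  After that, each relation between components that holds on all of \<open>U\<close> is
  differentiated along a fibre and gives further relations, until only the multiples of the metric
  are left.
\<close>

lemma parallel_form_M_beta:
  assumes \<beta>: "\<beta> > 0" and U: "open U" "U \<subseteq> points (M_beta \<beta>)"
    and bil: "\<And>x. x \<in> U \<Longrightarrow> bilinear (B x)"
    and sym: "\<And>x v w. x \<in> U \<Longrightarrow> B x v w = B x w v"
    and par: "\<And>x v w. x \<in> U \<Longrightarrow> ((\<lambda>y. B y v w) has_derivative (\<lambda>u.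
        B x (christoffel (M_beta \<beta>) x u v) w + B x v (christoffel (M_beta \<beta>) x u w))) (at x)"
    and x: "x \<in> U"
  shows "B x v w = B x (axis 1 1) (axis 1 1) * metric (M_beta \<beta>) x v w"
proof -
  define b where "b i j x = B x (axis i 1) (axis j 1)" for i j x
  define G where "G x k i = christoffel (M_beta \<beta>) x (axis k 1) (axis i 1)" for x k i
  have b_sym: "b i j x = b j i x" if "x \<in> U" for i j x
    unfolding b_def by (rule sym[OF that])
  have pos: "x $ 1 \<noteq> 0" "warp \<beta> x \<noteq> 0" if "x \<in> U" for x
    using factors_pos[OF \<beta>, of x] that U by auto
  define db where "db k i j x = B x (G x k i) (axis j 1) + B x (axis i 1) (G x k j)" for k i j x
  have warp_axis: "warp \<beta> (axis 1 1) = 1" "warp \<beta> (axis 2 1) = \<beta>" "warp \<beta> (axis 3 1) = 0" "warp \<beta> (axis 4 1) = 0"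
    by (simp_all add: warp_def)
  have G: "G x 1 1 = 0" "G x 1 2 = 0" "G x 3 1 = (1 / x $ 1) *\<^sub>R axis 3 1" "G x 3 2 = 0"
    "G x 3 3 = - x $ 1 *\<^sub>R axis 1 1" "G x 3 4 = 0" "G x 4 1 = (1 / warp \<beta> x) *\<^sub>R axis 4 1"
    "G x 4 2 = (\<beta> / warp \<beta> x) *\<^sub>R axis 4 1" "G x 4 3 = 0"
    "G x 4 4 = - warp \<beta> x *\<^sub>R axis 1 1 - (\<beta> * warp \<beta> x) *\<^sub>R axis 2 1" if "x \<in> U" for x
    using christoffel_M_beta[OF \<beta> subsetD[OF U(2) that]] unfolding G_def by (simp_all add: warp_axis)
  note bs = bilinear_ladd[OF bil] bilinear_radd[OF bil] bilinear_lsub[OF bil] bilinear_rsub[OF bil]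
    bilinear_lmul[OF bil] bilinear_rmul[OF bil] bilinear_lzero[OF bil] bilinear_rzero[OF bil]
    bilinear_lneg[OF bil] bilinear_rneg[OF bil]
  have has_db: "((\<lambda>y. b i j y) has_derivative (\<lambda>u. B x (christoffel (M_beta \<beta>) x u (axis i 1)) (axis j 1)
      + B x (axis i 1) (christoffel (M_beta \<beta>) x u (axis j 1)))) (at x)" if "x \<in> U" for i j x
    unfolding b_def by (rule par[OF that])
  \<comment> \<open>Differentiate a relation \<open>a b\<^sub>i\<^sub>j + c b' = 0\<close> along the
      coordinate field \<open>k\<close>; \<open>b'\<close> is a second component, and
      \<open>db k i j\<close> the derivative of \<open>b\<^sub>i\<^sub>j\<close>.\<close>
  have zero: "a x * db k i j x + c x * db k i' j' x + da (axis k 1) * b i j x + dc (axis k 1) * b i' j' x = 0"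
    if "x \<in> U" "\<And>y. y \<in> U \<Longrightarrow> a y * b i j y + c y * b i' j' y = 0"
      "(a has_derivative da) (at x)" "(c has_derivative dc) (at x)" for a c da dc k i j i' j' x
  proof -
    have "((\<lambda>y. a y * b i j y + c y * b i' j' y) has_derivative (\<lambda>h. 0)) (at x)"
      by (rule has_derivative_transform_within_open[OF has_derivative_const U(1) that(1), of 0])
        (simp add: that(2))
    from fun_cong[OF has_derivative_unique[OF this has_derivative_add[OF
          has_derivative_mult[OF that(3) has_db[OF that(1)]]
          has_derivative_mult[OF that(4) has_db[OF that(1)]]]], of "axis k 1"]
    show ?thesis by (simp add: db_def G_def)
  qed
  have zero': "db k i j x = 0" if "x \<in> U" "\<And>y. y \<in> U \<Longrightarrow> b i j y = 0" for k i j x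
    using zero[OF that(1), of "\<lambda>_. 1" i j "\<lambda>_. 0" i j "\<lambda>_. 0" "\<lambda>_. 0" k] that(2) by simp
  have b34: "b 3 4 x = 0" if x: "x \<in> U" for x
  proof -
    have "((\<lambda>y. - 2 * y $ 1 * b 1 3 y) has_derivative (\<lambda>u. - 2 * x $ 1 *
        (B x (christoffel (M_beta \<beta>) x u (axis 1 1)) (axis 3 1)
          + B x (axis 1 1) (christoffel (M_beta \<beta>) x u (axis 3 1))) - 2 * u $ 1 * b 1 3 x)) (at x)"
      (is "(_ has_derivative ?d) _")
      by (auto intro!: derivative_eq_intros has_db x)
    then have 3: "((\<lambda>y. B y (christoffel (M_beta \<beta>) y E3 E3) E3 + B y E3 (christoffel (M_beta \<beta>) y E3 E3))
      has_derivative ?d) (at x)"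
      by (rule has_derivative_transform_within_open[OF _ U(1) x])
        (simp add: G_def[symmetric] G bs b_def[symmetric] b_sym[of _ 3 1])
    \<comment> \<open>The derivative of \<open>b\<^sub>3\<^sub>3\<close> along \<open>4\<close> vanishes
        because \<open>\<Gamma>(4, 3) = 0\<close>.\<close>
    have 4: "((\<lambda>y. B y (christoffel (M_beta \<beta>) y E4 E3) E3 + B y E3 (christoffel (M_beta \<beta>) y E4 E3))
      has_derivative (\<lambda>u. 0)) (at x)"
      by (rule has_derivative_transform_within_open[OF has_derivative_const U(1) x, of 0])
        (simp add: G_def[symmetric] G bs)
    have "- 2 * x $ 1 * (B x (G x 4 1) E3 + B x (axis 1 1) (G x 4 3)) - 2 * E4 $ 1 * b 1 3 x = 0"
      using second_derivative_symmetric_real[OF U(1) x has_db[of _ 3 3] 3 4] unfolding G_def by simp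
    then show ?thesis
      using pos[OF x] b_sym[OF x, of 3 4] by (simp add: G[OF x] bs x b_def[symmetric])
  qed
  have b14: "b 1 4 x = 0" if x: "x \<in> U" for x
    using zero'[OF x b34, of 3] pos[OF x] by (simp add: db_def G[OF x] bs x b_def[symmetric])
  have b13_23: "b 1 3 x + \<beta> * b 2 3 x = 0" if x: "x \<in> U" for x
  proof -
    have "warp \<beta> x * (b 1 3 x + \<beta> * b 2 3 x) = 0"
      using zero'[OF x b34, of 4]
      by (simp add: db_def G[OF x] bs x b_def[symmetric] b_sym[OF x, of 3] algebra_simps)
    then show ?thesis using pos[OF x] by simp
  qed
  have b44: "b 4 4 x = (warp \<beta> x)\<^sup>2 * (b 1 1 x + \<beta> * b 1 2 x)" if x: "x \<in> U" for x
    using zero'[OF x b14, of 4] pos[OF x]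
    by (simp add: db_def G[OF x] bs x b_def[symmetric] field_simps power2_eq_square)
  have b33: "b 3 3 x = (x $ 1)\<^sup>2 * (b 1 1 x + \<beta> * b 1 2 x)" if x: "x \<in> U" for x
    using zero[OF x, of "\<lambda>_. 1" 1 3 "\<lambda>_. \<beta>" 2 3 "\<lambda>_. 0" "\<lambda>_. 0" 3] b13_23 pos[OF x]
    by (simp add: db_def G[OF x] bs x b_def[symmetric] b_sym[OF x, of 2 1] field_simps power2_eq_square)
  have b13: "b 1 3 x = 0" if x: "x \<in> U" for x
  proof -
    \<comment> \<open>Differentiate the formula for \<open>b\<^sub>3\<^sub>3\<close> along \<open>3\<close>:
        the left side gives \<open>- 2 f b\<^sub>1\<^sub>3\<close> and the right side
        \<open>f (2 b\<^sub>1\<^sub>3 + \<beta> b\<^sub>2\<^sub>3) = f b\<^sub>1\<^sub>3\<close>.\<close>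
    have d: "((\<lambda>y. (y $ 1)\<^sup>2 * (b 1 1 y + \<beta> * b 1 2 y)) has_derivative (\<lambda>u. 2 * x $ 1 * u $ 1 * (b 1 1 x + \<beta> * b 1 2 x)
      + (x $ 1)\<^sup>2 * ((B x (christoffel (M_beta \<beta>) x u (axis 1 1)) (axis 1 1)
      + B x (axis 1 1) (christoffel (M_beta \<beta>) x u (axis 1 1))) + \<beta> * (B x (christoffel (M_beta \<beta>) x u (axis 1 1)) (axis 2 1)
      + B x (axis 1 1) (christoffel (M_beta \<beta>) x u (axis 2 1)))))) (at x)"
      (is "(_ has_derivative ?d) _")
      by (auto intro!: derivative_eq_intros has_db x)
    have "((\<lambda>y. b 3 3 y) has_derivative ?d) (at x)"
      by (rule has_derivative_transform_within_open[OF d U(1) x]) (simp add: b33)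
    from fun_cong[OF has_derivative_unique[OF has_db[OF x] this], of E3]
    have "db 3 3 3 x = (x $ 1)\<^sup>2 * (db 3 1 1 x + \<beta> * db 3 1 2 x)"
      by (simp add: db_def G_def)
    then have "x $ 1 * x $ 1 * (4 * b 1 3 x + \<beta> * b 2 3 x) = 0"
      using pos[OF x]
      by (simp add: db_def G[OF x] bs x b_def[symmetric] b_sym[OF x, of 3] field_simps power2_eq_square)
    then have "4 * b 1 3 x + \<beta> * b 2 3 x = 0"
      using pos[OF x] by simp
    then show ?thesis using b13_23[OF x] by simp
  qed
  have b23: "b 2 3 x = 0" if x: "x \<in> U" for x
    using b13_23[OF x] b13[OF x] \<beta> by simp
  have b12: "b 1 2 x = 0" if x: "x \<in> U" for x
    using zero'[OF x b23, of 3] pos[OF x]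
    by (simp add: db_def G[OF x] bs x b_def[symmetric] b_sym[OF x, of 2 1])
  have b24: "b 2 4 x = 0" if x: "x \<in> U" for x
    using zero'[OF x b12, of 4] pos[OF x] b14[OF x]
    by (simp add: db_def G[OF x] bs x b_def[symmetric] b_sym[OF x, of 4])
  have b22: "b 2 2 x = b 1 1 x"
    using zero'[OF x b24, of 4] pos[OF x] b12[OF x] b44[OF x] \<beta>
    by (simp add: db_def G[OF x] bs x b_def[symmetric] b_sym[OF x, of 2 1] power2_eq_square)
  have expand: "z = z $ 1 *\<^sub>R axis 1 1 + z $ 2 *\<^sub>R axis 2 1 + z $ 3 *\<^sub>R axis 3 1 + z $ 4 *\<^sub>R axis 4 1"
    for z :: "real ^ 4" by (simp add: vec_eq_iff forall_4)
  have "B x v w = (\<Sum>i\<in>UNIV. \<Sum>j\<in>UNIV. v $ i * w $ j * b i j x)"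
    by (subst expand[of v], subst expand[of w]) (simp add: bs x b_def sum_4 algebra_simps)
  also have "\<dots> = b 1 1 x * metric (M_beta \<beta>) x v w"
    using b_sym[OF x, of 2 1] b_sym[OF x, of 3 1] b_sym[OF x, of 4 1] b_sym[OF x, of 3 2]
      b_sym[OF x, of 4 2] b_sym[OF x, of 4 3]
    by (simp add: sum_4 b12 b13 b14 b23 b24 b34 b22 b33 b44 x metric_M_beta algebra_simps)
  finally show ?thesis by (simp add: b_def)
qed

text \<open>
  The pulled back form vanishes on vectors tangent to the second factor, so as a multiple of the
  metric it is zero. But it is positive on vectors tangent to the first factor.
\<close>

lemma locally_irreducible_M_beta:
  assumes \<beta>: "\<beta> > 0"
  shows "\<not> locally_reducible_at TYPE('b::euclidean_space) TYPE('c::euclidean_space) (M_beta \<beta>) P"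
proof
  assume "locally_reducible_at TYPE('b) TYPE('c) (M_beta \<beta>) P"
  then obtain U and M1 :: "'b riem" and M2 :: "'c riem" where U: "open U" "P \<in> U" "U \<subseteq> points (M_beta \<beta>)"
    and M: "riemannian_manifold M1" "riemannian_manifold M2"
    and iso: "isometric (open_part (M_beta \<beta>) U) (riem_product M1 M2)"
    unfolding locally_reducible_at_def by blast
  note C1 = riemannian_manifold_imp_C1[OF M(1)] riemannian_manifold_imp_C1[OF M(2)]
  obtain \<phi> where \<phi>: "riem_isometry (open_part (M_beta \<beta>) U) (riem_product M1 M2) \<phi>"
    using isometric_obtain[OF iso C1_riemannian_open_part[OF C1_M_beta[OF \<beta>] U(1,3)]
        C1_riemannian_product[OF C1]] .
  then interpret riem_isometry "open_part (M_beta \<beta>) U" "riem_product M1 M2" \<phi> .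
  interpret M1: C1_riemannian M1 by (rule C1)
  have P: "P \<in> points (open_part (M_beta \<beta>) U)" using U by simp
  define B where "B x v w = metric M1 (fst (\<phi> x)) (fst (D x v)) (fst (D x w))" for x v w
  have g1: "inner_form (metric M1 (fst (\<phi> x)))" if "x \<in> U" for x
    using maps[of x] that by (intro M1.inner_form_metric) (auto simp: riem_product_def)
  have B: "B P v w = B P (axis 1 1) (axis 1 1) * metric (M_beta \<beta>) P v w" for v w
  proof (rule parallel_form_M_beta[OF \<beta> U(1,3) _ _ _ U(2)])
    fix x assume x: "x \<in> U"
    interpret g: inner_form "metric M1 (fst (\<phi> x))" by (rule g1[OF x])
    have lin: "linear (D x)" using D_linear x by simp
    show "bilinear (B x)"
      unfolding bilinear_def
      by (intro allI conjI linearI; simp add: B_def linear_add[OF lin] linear_cmul[OF lin])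
    show "B x v w = B x w v" for v w
      unfolding B_def by (rule g.sym)
    show "((\<lambda>y. B y v w) has_derivative (\<lambda>u.
        B x (christoffel (M_beta \<beta>) x u v) w + B x v (christoffel (M_beta \<beta>) x u w))) (at x)" for v w
      using product_form_parallel[OF C1 \<phi>, of x v w] x by (simp add: B_def)
  qed
  obtain a :: 'b where a: "a \<noteq> 0" using nonzero_Basis nonempty_Basis by blast
  obtain c :: 'c where c: "c \<noteq> 0" using nonzero_Basis nonempty_Basis by blast
  obtain v where v: "D P v = (a, 0)" using surj_D[OF P] by (metis surjD)
  obtain w where w: "D P w = (0, c)" using surj_D[OF P] by (metis surjD)
  interpret g1: inner_form "metric M1 (fst (\<phi> P))" by (rule g1[OF U(2)])
  interpret g: inner_form "metric (M_beta \<beta>) P"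
    using C1_riemannian.inner_form_metric[OF C1_M_beta[OF \<beta>]] U by auto
  have "w \<noteq> 0" using w c linear_0[OF D_linear[OF P]] by (auto simp: zero_prod_def)
  have "B P w w = 0" by (simp add: B_def w)
  then have "B P (axis 1 1) (axis 1 1) = 0" using g.pos[OF \<open>w \<noteq> 0\<close>] B[of w w] by simp
  then have "B P v v = 0" using B[of v v] by simp
  then show False using g1.pos[OF a] by (simp add: B_def v)
qed

section \<open>The parameter as an isometry invariant\<close>

text \<open>
  The area density \<open>f h\<close> of the fibres. It equals \<open>- 2 / \<tau>\<close>, and
  this makes it an isometry invariant.
\<close>

definition fibre_area :: "real \<Rightarrow> real ^ 4 \<Rightarrow> real" where
  "fibre_area \<beta> x = x $ 1 * warp \<beta> x"

definition grad_fibre_area :: "real \<Rightarrow> real ^ 4 \<Rightarrow> real ^ 4" where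
  "grad_fibre_area \<beta> x = (warp \<beta> x + x $ 1) *\<^sub>R axis 1 1 + (\<beta> * x $ 1) *\<^sub>R axis 2 1"

text \<open>
  The quotient \<open>\<bar>grad s\<bar>\<^sup>2 / s\<close> for \<open>s = f h\<close>. For fixed
  \<open>\<beta>\<close> it is a function of \<open>h / f\<close>.
\<close>

definition grad_ratio :: "real \<Rightarrow> real ^ 4 \<Rightarrow> real" where
  "grad_ratio \<beta> x = metric (M_beta \<beta>) x (grad_fibre_area \<beta> x) (grad_fibre_area \<beta> x) / fibre_area \<beta> x"

lemma fibre_area_has_derivative:
  "(fibre_area \<beta> has_derivative metric (M_beta \<beta>) x (grad_fibre_area \<beta> x)) (at x)"
proof -
  have "(fibre_area \<beta> has_derivative (\<lambda>h. x $ 1 * warp \<beta> h + h $ 1 * warp \<beta> x)) (at x)"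
    unfolding fibre_area_def by (auto intro!: derivative_eq_intros)
  also have "(\<lambda>h. x $ 1 * warp \<beta> h + h $ 1 * warp \<beta> x) = metric (M_beta \<beta>) x (grad_fibre_area \<beta> x)"
    by (simp add: fun_eq_iff metric_M_beta grad_fibre_area_def warp_def[of _ "_ :: real ^ 4"] algebra_simps)
  finally show ?thesis .
qed

lemma grad_ratio_eq:
  assumes "\<beta> > 0" "x \<in> points (M_beta \<beta>)"
  shows "grad_ratio \<beta> x = warp \<beta> x / x $ 1 + 2 + (1 + \<beta>\<^sup>2) * (x $ 1 / warp \<beta> x)"
  using factors_pos[OF assms]
  by (simp add: grad_ratio_def grad_fibre_area_def fibre_area_def metric_M_beta field_simps power2_eq_square)

lemma grad_ratio_has_derivative:
  assumes "\<beta> > 0" "x \<in> points (M_beta \<beta>)"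
  shows "(grad_ratio \<beta> has_derivative (\<lambda>h. warp \<beta> h / x $ 1 - warp \<beta> x * h $ 1 / (x $ 1)\<^sup>2
    + (1 + \<beta>\<^sup>2) * (h $ 1 / warp \<beta> x - x $ 1 * warp \<beta> h / (warp \<beta> x)\<^sup>2))) (at x)"
proof (rule has_derivative_transform_within_open[OF _ open_points_M_beta assms(2)])
  show "((\<lambda>x. warp \<beta> x / x $ 1 + 2 + (1 + \<beta>\<^sup>2) * (x $ 1 / warp \<beta> x)) has_derivative (\<lambda>h.
      warp \<beta> h / x $ 1 - warp \<beta> x * h $ 1 / (x $ 1)\<^sup>2
    + (1 + \<beta>\<^sup>2) * (h $ 1 / warp \<beta> x - x $ 1 * warp \<beta> h / (warp \<beta> x)\<^sup>2))) (at x)"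
    using factors_pos[OF assms]
    by (auto intro!: derivative_eq_intros simp: fun_eq_iff divide_inverse power2_eq_square algebra_simps)
qed (simp add: grad_ratio_eq[OF assms(1)])

lemma beta_invariant:
  assumes "\<beta> > 0" "x \<in> points (M_beta \<beta>)"
  shows "frechet_derivative (grad_ratio \<beta>) (at x) (grad_fibre_area \<beta> x) + (grad_ratio \<beta> x - 2)\<^sup>2
    = 4 * (1 + \<beta>\<^sup>2)"
proof -
  have pos: "x $ 1 \<noteq> 0" "warp \<beta> x \<noteq> 0" using factors_pos[OF assms] by auto
  have w: "warp \<beta> (grad_fibre_area \<beta> x) = warp \<beta> x + (1 + \<beta>\<^sup>2) * x $ 1"
    unfolding grad_fibre_area_def by (simp add: warp_def[of _ "_ + _"] power2_eq_square algebra_simps)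
  have g1: "grad_fibre_area \<beta> x $ 1 = warp \<beta> x + x $ 1"
    by (simp add: grad_fibre_area_def)
  show ?thesis
    unfolding fun_cong[OF frechet_derivative_at[OF grad_ratio_has_derivative[OF assms]], symmetric]
      grad_ratio_eq[OF assms] w g1
    using pos by (simp add: field_simps power2_eq_square)
qed

text \<open>
  The invariants \<open>s\<close>, then \<open>grad s\<close>, \<open>q = \<bar>grad
  s\<bar>\<^sup>2 / s\<close> and \<open>dq (grad s)\<close> of the two metrics correspond to each
  other under an isometry. The relation between them determines \<open>\<beta>\<^sup>2\<close>.
\<close>

lemma isometry_M_beta_parameter:
  assumes \<beta>: "\<beta> > 0" and \<gamma>: "\<gamma> > 0"
    and U: "open U" "U \<subseteq> points (M_beta \<beta>)" "P \<in> U" and V: "open V" "V \<subseteq> points (M_beta \<gamma>)"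
    and \<phi>: "riem_isometry (open_part (M_beta \<beta>) U) (open_part (M_beta \<gamma>) V) \<phi>"
  shows "\<beta> = \<gamma>"
proof -
  interpret riem_isometry "open_part (M_beta \<beta>) U" "open_part (M_beta \<gamma>) V" \<phi> by fact
  have pM: "x \<in> points (M_beta \<beta>)" "x \<in> points (open_part (M_beta \<beta>) U)" 
    and pN: "\<phi> x \<in> points (M_beta \<gamma>)" if "x \<in> U" for x
    using that U V maps[of x] by auto
  have s: "fibre_area \<gamma> (\<phi> x) = fibre_area \<beta> x" if x: "x \<in> U" for x
  proof -
    let ?f = "x $ 1" and ?h = "warp \<beta> x" and ?f' = "\<phi> x $ 1" and ?h' = "warp \<gamma> (\<phi> x)"
    note pos = factors_pos[OF \<beta> pM(1)[OF x]] and pos' = factors_pos[OF \<gamma> pN[OF x]]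
    define X where "X = D x E3"
    define Y where "Y = D x E4"
    note nat = curvature[OF pM(2)[OF x], unfolded christoffel_open_part riem_curvature_open_part,
        OF christoffel_M_beta_differentiable[OF \<beta> pM(1)[OF x]]
          christoffel_M_beta_differentiable[OF \<gamma> pN[OF x]]]
    note iso = isometry[OF pM(2)[OF x], unfolded metric_open_part]
    have lin: "linear (D x)" by (rule D_linear[OF pM(2)[OF x]])
    have "riem_curvature (M_beta \<beta>) x E3 E4 E4 = (- (?h / ?f)) *\<^sub>R E3"
      "riem_curvature (M_beta \<beta>) x E3 E4 E3 = (?f / ?h) *\<^sub>R E4"
      by (simp_all add: curvature_M_beta[OF \<beta> pM(1)[OF x]])
    then have "(- (?h / ?f)) *\<^sub>R X = riem_curvature (M_beta \<gamma>) (\<phi> x) X Y Y"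
      "(?f / ?h) *\<^sub>R Y = riem_curvature (M_beta \<gamma>) (\<phi> x) X Y X"
      using nat[of E3 E4 E4] nat[of E3 E4 E3] by (simp_all only: X_def Y_def linear_cmul[OF lin])
    then have X: "(- (?h / ?f)) *\<^sub>R X = area34 X Y *\<^sub>R ((- (?h' / ?f') * Y $ 4) *\<^sub>R E3 + (?f' / ?h' * Y $ 3) *\<^sub>R E4)"
      and Y: "(?f / ?h) *\<^sub>R Y = area34 X Y *\<^sub>R ((- (?h' / ?f') * X $ 4) *\<^sub>R E3 + (?f' / ?h' * X $ 3) *\<^sub>R E4)"
      by (simp_all only: curvature_M_beta[OF \<gamma> pN[OF x]])
    \<comment> \<open>The images of the fibre vectors are in the range of the curvature operator, which is the
        fibre plane.\<close>
    have X12: "X $ 1 = 0" "X $ 2 = 0"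
      using arg_cong[OF X, of "\<lambda>v. v $ 1"] arg_cong[OF X, of "\<lambda>v. v $ 2"] pos by simp_all
    have Y12: "Y $ 1 = 0" "Y $ 2 = 0"
      using arg_cong[OF Y, of "\<lambda>v. v $ 1"] arg_cong[OF Y, of "\<lambda>v. v $ 2"] pos by simp_all
    have XX: "?f'\<^sup>2 * (X $ 3)\<^sup>2 + ?h'\<^sup>2 * (X $ 4)\<^sup>2 = ?f\<^sup>2"
      using iso[of E3 E3] by (simp add: X_def[symmetric] metric_M_beta X12 power2_eq_square)
    have YY: "?f'\<^sup>2 * (Y $ 3)\<^sup>2 + ?h'\<^sup>2 * (Y $ 4)\<^sup>2 = ?h\<^sup>2"
      using iso[of E4 E4] by (simp add: Y_def[symmetric] metric_M_beta Y12 power2_eq_square)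
    have XY: "?f'\<^sup>2 * (X $ 3 * Y $ 3) + ?h'\<^sup>2 * (X $ 4 * Y $ 4) = 0"
      using iso[of E3 E4] by (simp add: X_def[symmetric] Y_def[symmetric] metric_M_beta X12)
    \<comment> \<open>Lagrange's identity: the image parallelogram has the same area.\<close>
    have "(?f' * ?h')\<^sup>2 * (area34 X Y)\<^sup>2 = (?f'\<^sup>2 * (X $ 3)\<^sup>2 + ?h'\<^sup>2 * (X $ 4)\<^sup>2) * (?f'\<^sup>2 * (Y $ 3)\<^sup>2 + ?h'\<^sup>2 * (Y $ 4)\<^sup>2)
        - (?f'\<^sup>2 * (X $ 3 * Y $ 3) + ?h'\<^sup>2 * (X $ 4 * Y $ 4))\<^sup>2"
      by (simp add: power2_eq_square algebra_simps)
    then have 1: "(?f' * ?h')\<^sup>2 * (area34 X Y)\<^sup>2 = (?f * ?h)\<^sup>2"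
      unfolding XX YY XY by (simp add: power_mult_distrib)
    have "curvature_tensor (M_beta \<gamma>) (\<phi> x) [X, Y, X, Y] = curvature_tensor (M_beta \<beta>) x [E3, E4, E3, E4]"
      unfolding curvature_tensor_def X_def Y_def by (simp add: nat[symmetric] iso)
    then have 2: "?f' * ?h' * (area34 X Y)\<^sup>2 = ?f * ?h"
      unfolding curvature_tensor_M_beta[OF \<gamma> pN[OF x]] curvature_tensor_M_beta[OF \<beta> pM(1)[OF x]]
      by (simp add: power2_eq_square)
    \<comment> \<open>With \<open>a = area34 X Y\<close>, the areas give \<open>(f' h')\<^sup>2 a\<^sup>2 =
        (f h)\<^sup>2\<close> and the curvatures \<open>f' h' a\<^sup>2 = f h\<close>; their
        quotient is \<open>f' h' = f h\<close>.\<close>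
    have "(?f' * ?h') * (?f * ?h) = (?f * ?h) * (?f * ?h)"
      using 1 unfolding 2[symmetric] by (simp add: power2_eq_square mult_ac)
    then show ?thesis using pos by (simp add: fibre_area_def)
  qed
  have grad: "D x (grad_fibre_area \<beta> x) = grad_fibre_area \<gamma> (\<phi> x)" if x: "x \<in> U" for x
    by (rule gradient[OF pM(2)[OF x] _ fibre_area_has_derivative fibre_area_has_derivative])
      (simp_all add: s)
  have q: "grad_ratio \<gamma> (\<phi> x) = grad_ratio \<beta> x" if x: "x \<in> U" for x
    unfolding grad_ratio_def s[OF x] grad[OF x, symmetric]
    using isometry[OF pM(2)[OF x], unfolded metric_open_part] by simp
  note dq = grad_ratio_has_derivative[OF \<beta> pM(1)[OF U(3)]] grad_ratio_has_derivative[OF \<gamma> pN[OF U(3)]]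
  have dq': "(grad_ratio \<beta> has_derivative frechet_derivative (grad_ratio \<beta>) (at P)) (at P)"
    "(grad_ratio \<gamma> has_derivative frechet_derivative (grad_ratio \<gamma>) (at (\<phi> P))) (at (\<phi> P))"
    using dq unfolding frechet_derivative_works[symmetric] differentiable_def by blast+
  have "((\<lambda>y. grad_ratio \<gamma> (\<phi> y)) has_derivative frechet_derivative (grad_ratio \<beta>) (at P)) (at P)"
    by (rule has_derivative_transform_within_open[OF dq'(1) U(1,3)]) (simp add: q)
  from fun_cong[OF has_derivative_unique[OF this compose_has_derivative[OF pM(2)[OF U(3)] dq'(2)]]]
  have "frechet_derivative (grad_ratio \<beta>) (at P) (grad_fibre_area \<beta> P)
    = frechet_derivative (grad_ratio \<gamma>) (at (\<phi> P)) (grad_fibre_area \<gamma> (\<phi> P))"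
    unfolding grad[OF U(3), symmetric] .
  then have "4 * (1 + \<beta>\<^sup>2) = 4 * (1 + \<gamma>\<^sup>2)"
    using beta_invariant[OF \<beta> pM(1)[OF U(3)]] beta_invariant[OF \<gamma> pN[OF U(3)]] q[OF U(3)] by simp
  then show ?thesis using \<beta> \<gamma> by (simp add: power2_eq_iff_nonneg)
qed

lemma not_locally_isometric_M_beta:
  assumes \<beta>: "\<beta> > 0" and \<gamma>: "\<gamma> > 0" and ne: "\<beta> \<noteq> \<gamma>"
  shows "\<not> locally_isometric (M_beta \<beta>) (M_beta \<gamma>)"
proof
  assume "locally_isometric (M_beta \<beta>) (M_beta \<gamma>)"
  then obtain U V where U: "open U" "U \<noteq> {}" "U \<subseteq> points (M_beta \<beta>)"
    and V: "open V" "V \<subseteq> points (M_beta \<gamma>)"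
    and iso: "isometric (open_part (M_beta \<beta>) U) (open_part (M_beta \<gamma>) V)"
    unfolding locally_isometric_def by blast
  obtain P where "P \<in> U" using U by blast
  obtain \<phi> where "riem_isometry (open_part (M_beta \<beta>) U) (open_part (M_beta \<gamma>) V) \<phi>"
    using isometric_obtain[OF iso C1_riemannian_open_part[OF C1_M_beta[OF \<beta>] U(1,3)]
        C1_riemannian_open_part[OF C1_M_beta[OF \<gamma>] V]] .
  from isometry_M_beta_parameter[OF \<beta> \<gamma> U(1,3) \<open>P \<in> U\<close> V this] ne show False by simp
qed

section \<open>The theorem\<close>

theorem theorem1p5:
  fixes \<beta> :: real
  assumes "\<beta> > 0"
  shows
    "(manifold_dim (M_beta \<beta>) = 4 \<and> riemannian_manifold (M_beta \<beta>) \<and> puffini_videv (M_beta \<beta>))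
   \<and> (\<forall>P\<in>points (M_beta \<beta>). indecomposable (k_model 2 (M_beta \<beta>) P) \<and>
        \<not> locally_reducible_at TYPE('b::euclidean_space) TYPE('c::euclidean_space) (M_beta \<beta>) P)
   \<and> (\<forall>\<gamma>>0. \<beta> \<noteq> \<gamma> \<longrightarrow> \<not> locally_isometric (M_beta \<beta>) (M_beta \<gamma>))
   \<and> (scalar_curvature_blowup (M_beta \<beta>) \<and> \<not> einstein (M_beta \<beta>))"
proof (intro conjI ballI allI impI)
  show "manifold_dim (M_beta \<beta>) = 4" by (simp add: manifold_dim_def)
  show "riemannian_manifold (M_beta \<beta>)" "puffini_videv (M_beta \<beta>)"
    "scalar_curvature_blowup (M_beta \<beta>)" "\<not> einstein (M_beta \<beta>)"
    using assms by (rule riemannian_M_beta puffini_videv_M_beta scalar_curvature_blowup_M_beta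
        not_einstein_M_beta)+
  show "\<not> locally_isometric (M_beta \<beta>) (M_beta \<gamma>)" if "\<gamma> > 0" "\<beta> \<noteq> \<gamma>" for \<gamma>
    using not_locally_isometric_M_beta[OF assms that] .
  fix P assume P: "P \<in> points (M_beta \<beta>)"
  show "indecomposable (k_model 2 (M_beta \<beta>) P)"
    using indecomposable_M_beta[OF assms P] by simp
  show "\<not> locally_reducible_at TYPE('b) TYPE('c) (M_beta \<beta>) P"
    by (rule locally_irreducible_M_beta[OF assms])
qed

end
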